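(* Let $m\geq 1$ be an integer and let $\sigma_{(m)}$ denote the $m$th second-order Steklov eigenvalue (without counting multiplicity). (1) Fix $A>0$. The $m$th Steklov eigenvalue $\sigma_{(m)}(K;A)$ on a geodesic disk of area $A$ in the space form $M_K^2$ is a strictly increasing function of the curvature $K\in(-\infty,4\pi/A)$. (2) Fix $\rho>0$. The $m$th Steklov eigenvalue $\sigma_{(m)}(K;\rho)$ on a geodesic disk of radius $\rho$ in the space form $M_K^2$ is a strictly increasing function of the curvature $K\in(-\infty,(\pi/\rho)^2)$.
   Context: For $K\in\mathbb{R}$, $M_K^2=[0,r_0)\times\mathbb{S}^{1}$ (with $\{0\}\times\mathbb{S}^1$ collapsed to a point) is the $2$-dimensional space form of constant curvature $K$, with metric $dr^2+h_K^2(r)g_{\mathbb{S}^1}$, where $h_K(r)=\frac{1}{\sqrt K}\sin(\sqrt K r)$ and $r_0=\pi/\sqrt K$ if $K>0$; $h_0(r)=r$ and $r_0=+\infty$ if $K=0$; $h_K(r)=\frac{1}{\sqrt{-K}}\sinh(\sqrt{-K}r)$ and $r_0=+\infty$ if $K<0$. Geodesic disks are closed disks $\{r\le R\}$ with $0<R<r_0$; "of area $A$" means $2\pi\int_0^R h_K(r)\,dr=A$. Second-order Steklov problem: on a smooth compact Riemannian manifold $M$ with boundary $\partial M$ and outward unit normal $\nu$, a real number $\sigma$ is an eigenvalue if there is a nontrivial $u$ with $\Delta u=0$ in $M$ and $\frac{\partial u}{\partial\nu}=\sigma u$ on $\partial M$. The spectrum is discrete, nonnegative and unbounded; the distinct eigenvalues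 (without counting multiplicity) are listed in increasing order as $0=\sigma_{(0)}<\sigma_{(1)}<\sigma_{(2)}<\cdots$. *)

theory Defs
  imports "HOL-Analysis.Analysis"
begin

text \<open>Calculus on open subsets of \<open>\<real>\<^sup>n\<close>.\<close>

definition partial :: "'n::finite \<Rightarrow> (real^'n \<Rightarrow> real) \<Rightarrow> real^'n \<Rightarrow> real" where
  "partial i f x = frechet_derivative f (at x) (axis i 1)"

definition smooth_on :: "(real^'n::finite) set \<Rightarrow> (real^'n \<Rightarrow> real) \<Rightarrow> bool" where
  "smooth_on U f \<longleftrightarrow> open U \<and> (\<forall>is. foldr partial is f differentiable_on U)"

text \<open>A Riemannian metric on a domain of \<open>\<real>\<^sup>n\<close> is given by its matrix \<open>(g\<^sub>i\<^sub>j)\<close> in the standard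
  coordinates.\<close>

definition laplace_beltrami ::
  "(real^'n::finite \<Rightarrow> real^'n^'n) \<Rightarrow> (real^'n \<Rightarrow> real) \<Rightarrow> real^'n \<Rightarrow> real" where
  "laplace_beltrami g u x =
     (\<Sum>i\<in>UNIV. partial i
        (\<lambda>y. sqrt (det (g y)) * (\<Sum>j\<in>UNIV. matrix_inv (g y) $ i $ j * partial j u y)) x)
     / sqrt (det (g x))"

text \<open>The unit normal, with respect to \<open>g\<close>, of the coordinate disk \<open>cball 0 R\<close> at a boundary
  point \<open>x\<close>; the tangent space of the boundary at \<open>x\<close> is \<open>{\<tau>. x \<bullet> \<tau> = 0}\<close>, and the vectors
  pointing out of the disk are those with \<open>x \<bullet> \<nu> > 0\<close>.\<close>

definition outward_unit_normal ::
  "(real^'n::finite \<Rightarrow> real^'n^'n) \<Rightarrow> real^'n \<Rightarrow> real^'n" where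
  "outward_unit_normal g x =
     (THE \<nu>. \<nu> \<bullet> (g x *v \<nu>) = 1 \<and> (\<forall>\<tau>. x \<bullet> \<tau> = 0 \<longrightarrow> \<nu> \<bullet> (g x *v \<tau>) = 0) \<and> x \<bullet> \<nu> > 0)"

text \<open>Smoothness up to the boundary means having a smooth extension to a neighbourhood of the
  closed disk; the values of the derivatives on the disk do not depend on the extension.\<close>

definition steklov_eigenvalue :: "(real^'n::finite \<Rightarrow> real^'n^'n) \<Rightarrow> real \<Rightarrow> real \<Rightarrow> bool" where
  "steklov_eigenvalue g R \<sigma> \<longleftrightarrow>
     (\<exists>u U. cball 0 R \<subseteq> U \<and> smooth_on U u \<and>
        (\<exists>x\<in>cball 0 R. u x \<noteq> 0) \<and>
        (\<forall>x\<in>cball 0 R. laplace_beltrami g u x = 0) \<and>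
        (\<forall>x\<in>sphere 0 R. frechet_derivative u (at x) (outward_unit_normal g x) = \<sigma> * u x))"

text \<open>The increasing list \<open>\<sigma>\<^sub>(\<^sub>0\<^sub>) < \<sigma>\<^sub>(\<^sub>1\<^sub>) < \<dots>\<close> of the distinct eigenvalues.\<close>

definition steklov_sigma :: "(real^'n::finite \<Rightarrow> real^'n^'n) \<Rightarrow> real \<Rightarrow> nat \<Rightarrow> real" where
  "steklov_sigma g R = (THE s. strict_mono s \<and> range s = {\<sigma>. steklov_eigenvalue g R \<sigma>})"

text \<open>The function \<open>h\<^sub>K\<close>.\<close>

definition warp :: "real \<Rightarrow> real \<Rightarrow> real" where
  "warp K r = (if K > 0 then sin (sqrt K * r) / sqrt K
               else if K = 0 then r
               else sinh (sqrt (- K) * r) / sqrt (- K))"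

text \<open>The space form is modelled in the coordinates \<open>x = (r cos \<theta>, r sin \<theta>)\<close>, which identify the
  disk \<open>{r \<le> R}\<close> with \<open>cball 0 R\<close> and in which \<open>dr\<^sup>2 + h\<^sub>K(r)\<^sup>2 d\<theta>\<^sup>2\<close> extends smoothly over the
  pole, where it is the identity matrix. The next two definitions are the components of the
  one-forms \<open>dr\<close> and \<open>d\<theta>\<close> in these coordinates, away from the pole.\<close>

definition dr :: "real^2 \<Rightarrow> real^2" where
  "dr x = (1 / norm x) *\<^sub>R x"

definition dtheta :: "real^2 \<Rightarrow> real^2" where
  "dtheta x = (1 / (norm x)\<^sup>2) *\<^sub>R vector [- (x $ 2), x $ 1]"

definition space_form_metric :: "real \<Rightarrow> real^2 \<Rightarrow> real^2^2" where
  "space_form_metric K x =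
     (if x = 0 then mat 1
      else (\<chi> i j. dr x $ i * dr x $ j + (warp K (norm x))\<^sup>2 * (dtheta x $ i * dtheta x $ j)))"

text \<open>The condition \<open>0 < R < r\<^sub>0\<close>, where \<open>r\<^sub>0 = \<infinity>\<close> for \<open>K \<le> 0\<close>.\<close>

definition admissible_radius :: "real \<Rightarrow> real \<Rightarrow> bool" where
  "admissible_radius K R \<longleftrightarrow> 0 < R \<and> (K > 0 \<longrightarrow> R < pi / sqrt K)"

definition disk_area :: "real \<Rightarrow> real \<Rightarrow> real" where
  "disk_area K R = 2 * pi * integral {0..R} (warp K)"

definition radius_of_area :: "real \<Rightarrow> real \<Rightarrow> real" where
  "radius_of_area K A = (THE R. admissible_radius K R \<and> disk_area K R = A)"

definition sigma_radius :: "nat \<Rightarrow> real \<Rightarrow> real \<Rightarrow> real" where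
  "sigma_radius m K \<rho> = steklov_sigma (space_form_metric K) \<rho> m"

definition sigma_area :: "nat \<Rightarrow> real \<Rightarrow> real \<Rightarrow> real" where
  "sigma_area m K A = sigma_radius m K (radius_of_area K A)"

end

theory Submission
  imports Defs
begin

text \<open>Write \<open>h = h\<^sub>K\<close>. In the isothermal coordinate \<open>w = F(r\<^sup>2) (x + i y)\<close> (stereographic projection) the
  functions \<open>Re w\<^sup>k\<close> are harmonic with \<open>h \<partial>u/\<partial>r = k u\<close>, so \<open>k / h(R)\<close> is a Steklov eigenvalue for every
  \<open>k\<close>. Conversely, every Fourier coefficient \<open>a(r)\<close> of a harmonic function at frequency \<open>k\<close> satisfies
  \<open>h a' = k a\<close>, so that for an eigenvalue different from all \<open>k / h(R)\<close> all coefficients vanish. Hence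
  \<open>\<sigma>\<^sub>(\<^sub>m\<^sub>) = m / h(R)\<close>, and it remains to see that \<open>h(R)\<close> decreases in \<open>K\<close>: for fixed radius this is
  Sturm comparison, for fixed area it follows from \<open>4 \<pi>\<^sup>2 h(R)\<^sup>2 = 4 \<pi> A - K A\<^sup>2\<close>.\<close>

section \<open>Smooth functions and the symmetry of second derivatives\<close>

text \<open>\<open>steklov_sigma\<close> is a definite description over the whole spectrum, so the
  eigenvalues have to be determined exactly; bounds on single eigenvalues would not do. The obstacle
  is the pole, where polar coordinates break down while eigenfunctions are smooth in x and y. Two
  devices deal with it. The quotient h(r) / r is an entire power series in r^2, so it composes with
  \<open>x \<bullet> x\<close> to a smooth function, for all signs of \<open>K\<close> at once. And
  d/dr is replaced by r d/dr, which like d/d\<theta> has polynomial coefficients in x and y. A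
  Fourier coefficient a at first satisfies only the second-order equation h (h a')' = k^2 a, whose
  solutions for k > 0 behave like r^k and r^(-k) at the pole. Continuity at the pole excludes the
  second kind, and this is where the first-order equation comes from. Harmonicity of Re w^k is not
  checked by computing a Laplacian: its conjugate Im w^k reduces it to the symmetry of second
  derivatives, which is why that symmetry is established for smooth functions.\<close>

lemma frechet_derivative_cong_open:
  fixes f g :: "real^'n::finite \<Rightarrow> real"
  assumes "open U" "x \<in> U" "\<And>y. y \<in> U \<Longrightarrow> f y = g y"
  shows "frechet_derivative f (at x) = frechet_derivative g (at x)"
proof -
  have "(f has_derivative f') (at x) \<longleftrightarrow> (g has_derivative f') (at x)" for f'
    using has_derivative_transform_within_open[of f f' x UNIV U g]
      has_derivative_transform_within_open[of g f' x UNIV U f] assms by auto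
  then show ?thesis by (simp add: frechet_derivative_def)
qed

lemma partial_cong_open:
  assumes "open U" "x \<in> U" "\<And>y. y \<in> U \<Longrightarrow> f y = g y"
  shows "partial i f x = partial i g x"
  unfolding partial_def using frechet_derivative_cong_open[OF assms] by simp

lemma sum_axis_mult:
  fixes F :: "'n::finite \<Rightarrow> real"
  shows "(\<Sum>k\<in>UNIV. axis i c $ k * F k) = c * F i"
proof -
  have "axis i c $ k * F k = (if k = i then c * F i else 0)" for k
    by (simp add: axis_def)
  then show ?thesis by simp
qed

lemma partial_eqI:
  assumes "(f has_derivative f') (at x)"
  shows "partial i f x = f' (axis i 1)"
  unfolding partial_def using frechet_derivative_at[OF assms] by simp

lemma has_derivative_partial:
  fixes f :: "real^'n::finite \<Rightarrow> real"
  assumes "f differentiable (at x)"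
  shows "(f has_derivative (\<lambda>h. \<Sum>i\<in>UNIV. h $ i * partial i f x)) (at x)"
proof -
  let ?D = "frechet_derivative f (at x)"
  have D: "(f has_derivative ?D) (at x)"
    using assms frechet_derivative_works by blast
  then interpret linear ?D by (rule has_derivative_linear)
  have "?D h = (\<Sum>i\<in>UNIV. h $ i * partial i f x)" for h
  proof -
    have "?D h = ?D (\<Sum>i\<in>UNIV. h $ i *\<^sub>R axis i 1)"
      by (simp add: basis_expansion flip: scalar_mult_eq_scaleR)
    then show ?thesis by (simp add: sum scale partial_def)
  qed
  then have "?D = (\<lambda>h. \<Sum>i\<in>UNIV. h $ i * partial i f x)" by (rule ext)
  with D show ?thesis by simp
qed

text \<open>\<open>foldr\<close> applies the last index of the list first, so lists are split at
  their end: \<open>is @ [i]\<close> turns a derivative of \<open>f\<close> into a derivative of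
  \<open>partial i f\<close>.\<close>

lemma smooth_on_iff:
  "smooth_on U f \<longleftrightarrow> open U \<and> f differentiable_on U \<and> (\<forall>i. smooth_on U (partial i f))"
proof
  assume R: "open U \<and> f differentiable_on U \<and> (\<forall>i. smooth_on U (partial i f))"
  show "smooth_on U f"
    unfolding smooth_on_def
  proof (intro conjI allI)
    show "foldr partial is f differentiable_on U" for "is"
      using R by (cases "is" rule: rev_cases) (auto simp: smooth_on_def)
  qed (use R in simp)
next
  assume L: "smooth_on U f"
  have "foldr partial is (partial i f) differentiable_on U" for "is" i
    using L[unfolded smooth_on_def, THEN conjunct2, THEN spec, of "is @ [i]"] by simp
  moreover have "f differentiable_on U"
    using L[unfolded smooth_on_def, THEN conjunct2, THEN spec, of "[]"] by simp
  ultimately show "open U \<and> f differentiable_on U \<and> (\<forall>i. smooth_on U (partial i f))"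
    using L by (simp add: smooth_on_def)
qed

lemma smooth_on_open: "smooth_on U f \<Longrightarrow> open U"
  by (simp add: smooth_on_def)

lemma smooth_on_partial: "smooth_on U f \<Longrightarrow> smooth_on U (partial i f)"
  using smooth_on_iff by blast

lemma smooth_on_differentiable: "smooth_on U f \<Longrightarrow> x \<in> U \<Longrightarrow> f differentiable (at x)"
  by (metis smooth_on_iff differentiable_on_eq_differentiable_at)

lemma smooth_on_has_derivative:
  "smooth_on U f \<Longrightarrow> x \<in> U \<Longrightarrow>
    (f has_derivative (\<lambda>h. \<Sum>i\<in>UNIV. h $ i * partial i f x)) (at x)"
  by (intro has_derivative_partial smooth_on_differentiable)

lemma smooth_on_continuous_on: "smooth_on U f \<Longrightarrow> continuous_on U f"
  using smooth_on_iff differentiable_imp_continuous_on by blast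

text \<open>Smoothness as a greatest fixed point. The partial derivatives have to agree with members
  of \<open>S\<close> only on \<open>U\<close>, because nothing is known about
  \<open>frechet_derivative\<close> outside; as \<open>U\<close> is open, the agreement passes on to
  the next derivative.\<close>

lemma smooth_on_coinduct:
  assumes "f \<in> S" and U: "open U"
    and diff: "\<And>g. g \<in> S \<Longrightarrow> g differentiable_on U"
    and step: "\<And>g i. g \<in> S \<Longrightarrow> \<exists>g'\<in>S. \<forall>x\<in>U. partial i g x = g' x"
  shows "smooth_on U f"
proof -
  have "\<exists>g\<in>S. \<forall>x\<in>U. foldr partial is f x = g x" for "is"
  proof (induction "is")
    case Nil
    then show ?case using assms(1) by auto
  next
    case (Cons i "is")
    then obtain g where g: "g \<in> S" "\<And>x. x \<in> U \<Longrightarrow> foldr partial is f x = g x" by blast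
    obtain g' where "g' \<in> S" "\<forall>x\<in>U. partial i g x = g' x" using step g(1) by blast
    moreover have "partial i (foldr partial is f) x = partial i g x" if "x \<in> U" for x
      using partial_cong_open[OF U that] g(2) by blast
    ultimately show ?case by (metis foldr.simps(2) comp_apply)
  qed
  then have "foldr partial is f differentiable_on U" for "is"
  proof -
    obtain g where g: "g \<in> S" "\<forall>x\<in>U. foldr partial is f x = g x"
      using \<open>\<And>is. \<exists>g\<in>S. \<forall>x\<in>U. foldr partial is f x = g x\<close> by blast
    show ?thesis
      unfolding differentiable_on_def
    proof
      fix x assume x: "x \<in> U"
      with diff[OF g(1)] have "g differentiable (at x within U)" by (auto simp: differentiable_on_def)
      then show "foldr partial is f differentiable (at x within U)"
        using g(2) x by (auto intro: differentiable_transform_within[of g x U 1])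
    qed
  qed
  then show ?thesis
    unfolding smooth_on_def using U by blast
qed

section \<open>Closure properties of smooth functions\<close>

lemma smooth_on_const: "open U \<Longrightarrow> smooth_on U (\<lambda>x. c)"
proof (rule smooth_on_coinduct[where S = "range (\<lambda>c x. c)"])
  fix g :: "real^'a \<Rightarrow> real" and i assume "g \<in> range (\<lambda>c x. c)"
  then show "\<exists>g'\<in>range (\<lambda>c x. c). \<forall>x\<in>U. partial i g x = g' x"
    by (auto simp: partial_def)
qed auto

lemma smooth_on_nth:
  assumes "open U"
  shows "smooth_on U (\<lambda>x :: real^'n::finite. x $ j)"
proof -
  have d: "((\<lambda>x. x $ j) has_derivative (\<lambda>h. h $ j)) (at x)" for x :: "real^'n"
    by (rule bounded_linear_imp_has_derivative[OF bounded_linear_vec_nth])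
  then have "partial i (\<lambda>x. x $ j) = (\<lambda>x. axis i 1 $ j)" for i
    by (intro ext partial_eqI)
  moreover have "(\<lambda>x::real^'n. x $ j) differentiable_on U"
    using d by (auto simp: differentiable_on_def differentiable_def intro: has_derivative_at_withinI)
  ultimately show ?thesis
    unfolding smooth_on_iff[of U "\<lambda>x. x $ j"] using assms by (auto intro: smooth_on_const)
qed

text \<open>A derivative of a product is a sum of products, so induction on the list of indices does
  not close for each operation separately. This set contains everything that differentiation can
  produce and serves as the \<open>S\<close> of \<open>smooth_on_coinduct\<close>.\<close>

inductive_set smooth_closure :: "(real^'n::finite) set \<Rightarrow> (real^'n \<Rightarrow> real) set"
  for U where
  base: "smooth_on U f \<Longrightarrow> f \<in> smooth_closure U"
| add: "f \<in> smooth_closure U \<Longrightarrow> g \<in> smooth_closure U \<Longrightarrow> (\<lambda>x. f x + g x) \<in> smooth_closure U"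
| mult: "f \<in> smooth_closure U \<Longrightarrow> g \<in> smooth_closure U \<Longrightarrow> (\<lambda>x. f x * g x) \<in> smooth_closure U"
| inverse: "f \<in> smooth_closure U \<Longrightarrow> (\<forall>x\<in>U. f x \<noteq> 0) \<Longrightarrow>
    (\<lambda>x. inverse (f x)) \<in> smooth_closure U"
| series: "f \<in> smooth_closure U \<Longrightarrow> (\<forall>t. summable (\<lambda>n. a n * t ^ n)) \<Longrightarrow>
    (\<lambda>x. \<Sum>n. a n * f x ^ n) \<in> smooth_closure U"

lemma entire_series_derivative:
  fixes a :: "nat \<Rightarrow> real"
  assumes "\<And>t. summable (\<lambda>n. a n * t ^ n)"
  shows "((\<lambda>t. \<Sum>n. a n * t ^ n) has_real_derivative (\<Sum>n. diffs a n * t ^ n)) (at t)"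
    and "summable (\<lambda>n. diffs a n * t ^ n)"
proof -
  show "summable (\<lambda>n. diffs a n * t ^ n)"
    by (rule termdiff_converges_all) (fact assms)
  show "((\<lambda>t. \<Sum>n. a n * t ^ n) has_real_derivative (\<Sum>n. diffs a n * t ^ n)) (at t)"
    by (rule termdiffs_strong_converges_everywhere) (fact assms)
qed

lemma smooth_closure_smooth:
  assumes U: "open U" and f: "f \<in> smooth_closure U"
  shows "smooth_on U f"
proof -
  define good where "good g \<longleftrightarrow> (\<forall>x\<in>U. g differentiable (at x)) \<and>
    (\<forall>i. \<exists>g'\<in>smooth_closure U. \<forall>x\<in>U. partial i g x = g' x)" for g
  \<comment> \<open>Each case of the induction only has to exhibit a derivative whose values on the
    axis vectors are again in the closure.\<close>
  have good_intro: "good g" if "\<And>x. x \<in> U \<Longrightarrow> (g has_derivative (\<lambda>h. G h x)) (at x)"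
    "\<And>i. (\<lambda>x. G (axis i 1) x) \<in> smooth_closure U" for g G
    unfolding good_def
  proof (intro conjI ballI allI)
    show "g differentiable at x" if "x \<in> U" for x
      using \<open>\<And>x. x \<in> U \<Longrightarrow> (g has_derivative (\<lambda>h. G h x)) (at x)\<close>[OF that]
      by (rule differentiableI)
    show "\<exists>g'\<in>smooth_closure U. \<forall>x\<in>U. partial i g x = g' x" for i
      by (rule bexI[OF _ that(2)[of i]]) (auto intro: partial_eqI[OF that(1)])
  qed
  have hd: "(g has_derivative (\<lambda>h. \<Sum>i\<in>UNIV. h $ i * partial i g x)) (at x)"
    if "good g" "x \<in> U" for g x
    using that by (intro has_derivative_partial) (auto simp: good_def)
  have exP: "\<exists>P. (\<forall>i. P i \<in> smooth_closure U) \<and> (\<forall>i. \<forall>x\<in>U. partial i g x = P i x)" if "good g" for g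
    using that unfolding good_def by metis
  have ob: "\<exists>P. (\<forall>i. P i \<in> smooth_closure U) \<and>
      (\<forall>x\<in>U. (g has_derivative (\<lambda>h. \<Sum>i\<in>UNIV. h $ i * P i x)) (at x))" if g: "good g" for g
  proof -
    obtain P where P: "\<And>i. P i \<in> smooth_closure U" "\<And>i x. x \<in> U \<Longrightarrow> partial i g x = P i x"
      using exP[OF g] by auto
    have "(g has_derivative (\<lambda>h. \<Sum>i\<in>UNIV. h $ i * P i x)) (at x)" if "x \<in> U" for x
      using hd[OF g that] P(2)[OF that] by simp
    with P(1) show ?thesis by blast
  qed
  have ax: "(\<Sum>k\<in>UNIV. axis i 1 $ k * P k x) = P i x" for i and P :: "'n \<Rightarrow> real^'n \<Rightarrow> real" and x
    by (simp add: sum_axis_mult)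
  have const: "(\<lambda>x. c) \<in> smooth_closure U" for c
    by (intro smooth_closure.base smooth_on_const U)
  have good: "good g" if "g \<in> smooth_closure U" for g
    using that
  proof induction
    case (base f)
    then show ?case
      unfolding good_def by (auto intro: smooth_on_differentiable smooth_closure.base smooth_on_partial)
  next
    case (add f g)
    obtain P where P: "\<And>i. P i \<in> smooth_closure U"
      "\<And>x. x \<in> U \<Longrightarrow> (f has_derivative (\<lambda>h. \<Sum>i\<in>UNIV. h $ i * P i x)) (at x)"
      using ob[OF add.IH(1)] by blast
    obtain Q where Q: "\<And>i. Q i \<in> smooth_closure U"
      "\<And>x. x \<in> U \<Longrightarrow> (g has_derivative (\<lambda>h. \<Sum>i\<in>UNIV. h $ i * Q i x)) (at x)"
      using ob[OF add.IH(2)] by blast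
    show ?case
    proof (rule good_intro)
      show "((\<lambda>x. f x + g x) has_derivative (\<lambda>h. (\<Sum>i\<in>UNIV. h $ i * P i x) + (\<Sum>i\<in>UNIV. h $ i * Q i x))) (at x)"
        if "x \<in> U" for x
        using P(2)[OF that] Q(2)[OF that] by (rule has_derivative_add)
    qed (unfold ax, intro smooth_closure.add P Q)
  next
    case (mult f g)
    obtain P where P: "\<And>i. P i \<in> smooth_closure U"
      "\<And>x. x \<in> U \<Longrightarrow> (f has_derivative (\<lambda>h. \<Sum>i\<in>UNIV. h $ i * P i x)) (at x)"
      using ob[OF mult.IH(1)] by blast
    obtain Q where Q: "\<And>i. Q i \<in> smooth_closure U"
      "\<And>x. x \<in> U \<Longrightarrow> (g has_derivative (\<lambda>h. \<Sum>i\<in>UNIV. h $ i * Q i x)) (at x)"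
      using ob[OF mult.IH(2)] by blast
    show ?case
    proof (rule good_intro)
      show "((\<lambda>x. f x * g x) has_derivative (\<lambda>h. f x * (\<Sum>i\<in>UNIV. h $ i * Q i x) + (\<Sum>i\<in>UNIV. h $ i * P i x) * g x)) (at x)"
        if "x \<in> U" for x
        using P(2)[OF that] Q(2)[OF that] by (rule has_derivative_mult)
    qed (unfold ax, intro smooth_closure.add smooth_closure.mult P Q mult.hyps)
  next
    case (inverse f)
    obtain P where P: "\<And>i. P i \<in> smooth_closure U"
      "\<And>x. x \<in> U \<Longrightarrow> (f has_derivative (\<lambda>h. \<Sum>i\<in>UNIV. h $ i * P i x)) (at x)"
      using ob[OF inverse.IH(1)] by blast
    show ?case
    proof (rule good_intro)
      show "((\<lambda>x. inverse (f x)) has_derivative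
          (\<lambda>h. (-1) * ((inverse (f x) * (\<Sum>i\<in>UNIV. h $ i * P i x)) * inverse (f x)))) (at x)"
        if "x \<in> U" for x
        using Deriv.has_derivative_inverse[OF _ P(2)[OF that]] that inverse.hyps by simp
    qed (unfold ax, intro smooth_closure.mult smooth_closure.inverse P const inverse.hyps)
  next
    case (series f a)
    obtain P where P: "\<And>i. P i \<in> smooth_closure U"
      "\<And>x. x \<in> U \<Longrightarrow> (f has_derivative (\<lambda>h. \<Sum>i\<in>UNIV. h $ i * P i x)) (at x)"
      using ob[OF series.IH(1)] by blast
    show ?case
    proof (rule good_intro)
      show "((\<lambda>x. \<Sum>n. a n * f x ^ n) has_derivative
          (\<lambda>h. (\<Sum>n. diffs a n * f x ^ n) * (\<Sum>i\<in>UNIV. h $ i * P i x))) (at x)"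
        if "x \<in> U" for x
        using has_derivative_compose[OF P(2)[OF that]
            entire_series_derivative(1)[of a, unfolded has_field_derivative_def]] series.hyps
        by simp
    qed (unfold ax, intro smooth_closure.mult smooth_closure.series P series.hyps, use series.hyps entire_series_derivative(2)[of a] in auto)
  qed
  show ?thesis
    by (rule smooth_on_coinduct[OF f U])
       (use good U in \<open>auto simp: good_def differentiable_on_eq_differentiable_at\<close>)
qed

lemma smooth_on_add: "smooth_on U f \<Longrightarrow> smooth_on U g \<Longrightarrow> smooth_on U (\<lambda>x. f x + g x)"
  and smooth_on_mult: "smooth_on U f \<Longrightarrow> smooth_on U g \<Longrightarrow> smooth_on U (\<lambda>x. f x * g x)"
  and smooth_on_inverse: "smooth_on U f \<Longrightarrow> (\<And>x. x \<in> U \<Longrightarrow> f x \<noteq> 0) \<Longrightarrow>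
    smooth_on U (\<lambda>x. inverse (f x))"
  and smooth_on_series: "smooth_on U f \<Longrightarrow> (\<And>t. summable (\<lambda>n. a n * t ^ n)) \<Longrightarrow>
    smooth_on U (\<lambda>x. \<Sum>n. a n * f x ^ n)"
  by (blast intro: smooth_closure_smooth smooth_closure.intros dest: smooth_on_open)+

lemma smooth_on_diff:
  assumes "smooth_on U f" "smooth_on U g"
  shows "smooth_on U (\<lambda>x. f x - g x)"
  using smooth_on_add[OF assms(1) smooth_on_mult[OF smooth_on_const[of U "-1"] assms(2)]]
    smooth_on_open[OF assms(1)] by simp

section \<open>Symmetry of second partial derivatives\<close>

lemma smooth_on_line_derivative:
  assumes "smooth_on U f" "x + t *\<^sub>R axis i 1 \<in> U"
  shows "((\<lambda>s. f (x + s *\<^sub>R axis i 1)) has_real_derivative partial i f (x + t *\<^sub>R axis i 1)) (at t)"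
proof -
  have "((\<lambda>s. x + s *\<^sub>R axis i 1) has_derivative (\<lambda>h. h *\<^sub>R axis i 1)) (at t)"
    by (auto intro!: derivative_eq_intros)
  from has_derivative_compose[OF this smooth_on_has_derivative[OF assms]]
  have "((\<lambda>s. f (x + s *\<^sub>R axis i 1)) has_derivative (\<lambda>h. h * partial i f (x + t *\<^sub>R axis i 1))) (at t)"
    by (simp add: mult.assoc sum_axis_mult flip: sum_distrib_left)
  then show ?thesis
    by (simp add: has_field_derivative_def mult_commute_abs)
qed

text \<open>Two mean value theorems, first in direction \<open>i\<close> for \<phi>, then in
  direction \<open>j\<close> for \<psi>. The left side is symmetric in \<open>i\<close> and
  \<open>j\<close>, the right side is not; this asymmetry is what is exploited. The bound on
  \<open>t\<close> keeps the parallelogram inside the ball.\<close>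

lemma second_difference_mean_value:
  assumes f: "smooth_on U f" and B: "ball x \<delta> \<subseteq> U" and t: "0 < t" "2 * t < \<delta>"
  shows "\<exists>p\<in>ball x \<delta>. f (x + t *\<^sub>R axis i 1 + t *\<^sub>R axis j 1) - f (x + t *\<^sub>R axis i 1)
    - f (x + t *\<^sub>R axis j 1) + f x = t\<^sup>2 * partial j (partial i f) p"
proof -
  have in_ball: "x + a *\<^sub>R axis i 1 + b *\<^sub>R axis j 1 \<in> ball x \<delta>"
    if "0 \<le> a" "a \<le> t" "0 \<le> b" "b \<le> t" for a b
  proof -
    have "dist x (x + a *\<^sub>R axis i 1 + b *\<^sub>R axis j 1) = norm (a *\<^sub>R axis i (1::real) + b *\<^sub>R axis j 1)"
      by (metis add.assoc dist_norm norm_minus_commute add_diff_cancel_left')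
    also have "\<dots> \<le> norm (a *\<^sub>R axis i (1::real) :: real^'a) + norm (b *\<^sub>R axis j (1::real) :: real^'a)"
      by (rule norm_triangle_ineq)
    also have "\<dots> \<le> t + t" using that by simp
    finally show ?thesis using t by simp
  qed
  have in_U: "x + a *\<^sub>R axis i 1 + b *\<^sub>R axis j 1 \<in> U" "x + a *\<^sub>R axis i 1 \<in> U"
    if "0 \<le> a" "a \<le> t" "0 \<le> b" "b \<le> t" for a b
    using in_ball[of a b] in_ball[of a 0] that B t by auto
  define \<phi> where "\<phi> s = f (x + t *\<^sub>R axis j 1 + s *\<^sub>R axis i 1) - f (x + s *\<^sub>R axis i 1)" for s
  have "DERIV \<phi> s :> partial i f (x + t *\<^sub>R axis j 1 + s *\<^sub>R axis i 1) - partial i f (x + s *\<^sub>R axis i 1)"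
    if "0 \<le> s" "s \<le> t" for s
    unfolding \<phi>_def using in_U[of s t] that t
    by (intro DERIV_diff smooth_on_line_derivative[OF f]) (auto simp: add_ac)
  from MVT2[OF t(1) this] obtain s where s: "0 < s" "s < t" and
    1: "\<phi> t - \<phi> 0 = t * (partial i f (x + t *\<^sub>R axis j 1 + s *\<^sub>R axis i 1) - partial i f (x + s *\<^sub>R axis i 1))"
    by auto
  define \<psi> where "\<psi> r = partial i f (x + s *\<^sub>R axis i 1 + r *\<^sub>R axis j 1)" for r
  have "DERIV \<psi> r :> partial j (partial i f) (x + s *\<^sub>R axis i 1 + r *\<^sub>R axis j 1)"
    if "0 \<le> r" "r \<le> t" for r
    unfolding \<psi>_def using in_U[of s r] that s
    by (intro smooth_on_line_derivative[OF smooth_on_partial[OF f]]) auto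
  from MVT2[OF t(1) this] obtain r where r: "0 < r" "r < t" and
    2: "\<psi> t - \<psi> 0 = t * partial j (partial i f) (x + s *\<^sub>R axis i 1 + r *\<^sub>R axis j 1)"
    by auto
  have "\<phi> t - \<phi> 0 = t * (\<psi> t - \<psi> 0)"
    unfolding 1 by (simp add: \<psi>_def add_ac)
  then have "\<phi> t - \<phi> 0 = t\<^sup>2 * partial j (partial i f) (x + s *\<^sub>R axis i 1 + r *\<^sub>R axis j 1)"
    by (simp add: 2 power2_eq_square)
  moreover have "x + s *\<^sub>R axis i 1 + r *\<^sub>R axis j 1 \<in> ball x \<delta>"
    using in_ball[of s r] s r by simp
  ultimately show ?thesis
    by (intro bexI) (auto simp: \<phi>_def add_ac)
qed

text \<open>Evaluating the same second difference in both orders gives points \<open>p\<close> and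
  \<open>q\<close> near \<open>x\<close> at which the two mixed derivatives agree; by continuity
  each is within \<open>e/2\<close> of its value at \<open>x\<close>, which contradicts a gap of
  size \<open>e\<close>.\<close>

lemma partial_commute:
  assumes f: "smooth_on U f" and x: "x \<in> U"
  shows "partial i (partial j f) x = partial j (partial i f) x"
proof (rule ccontr)
  define e where "e = \<bar>partial i (partial j f) x - partial j (partial i f) x\<bar>"
  assume "\<not> ?thesis"
  then have e: "e > 0" by (simp add: e_def)
  have "\<exists>d>0. \<forall>y. dist y x < d \<longrightarrow> dist (partial i (partial j f) y) (partial i (partial j f) x) < e/2" for i j
    using smooth_on_continuous_on[OF smooth_on_partial[OF smooth_on_partial[OF f]]]
      smooth_on_open[OF f] x e
    by (metis continuous_at_eps_delta continuous_on_eq_continuous_at half_gt_zero dist_commute)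
  then obtain d1 d2 where d: "d1 > 0" "d2 > 0"
    "\<And>y. dist y x < d1 \<Longrightarrow> dist (partial i (partial j f) y) (partial i (partial j f) x) < e/2"
    "\<And>y. dist y x < d2 \<Longrightarrow> dist (partial j (partial i f) y) (partial j (partial i f) x) < e/2"
    by metis
  obtain d3 where d3: "d3 > 0" "ball x d3 \<subseteq> U"
    using smooth_on_open[OF f] x open_contains_ball by blast
  define \<delta> where "\<delta> = min d3 (min d1 d2)"
  have B: "ball x \<delta> \<subseteq> U" and \<delta>: "\<delta> > 0" using d3 d by (auto simp: \<delta>_def)
  have t: "0 < \<delta>/3" "2 * (\<delta>/3) < \<delta>" using \<delta> by auto
  obtain p q where pq: "p \<in> ball x \<delta>" "q \<in> ball x \<delta>"
    "(\<delta>/3)\<^sup>2 * partial j (partial i f) p = (\<delta>/3)\<^sup>2 * partial i (partial j f) q"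
    using second_difference_mean_value[OF f B t, of i j] second_difference_mean_value[OF f B t, of j i]
    by (auto simp: algebra_simps)
  then have "partial j (partial i f) p = partial i (partial j f) q" using \<delta> by simp
  moreover have "dist (partial j (partial i f) p) (partial j (partial i f) x) < e/2"
    "dist (partial i (partial j f) q) (partial i (partial j f) x) < e/2"
    using pq d by (auto simp: \<delta>_def dist_commute)
  ultimately show False unfolding e_def dist_real_def by argo
qed

section \<open>The warping function as a power series in \<open>r\<^sup>2\<close>\<close>

text \<open>With t = r^2 this is h(r) / r, that is sin (q r) / (q r) with q = \<open>sqrt K\<close>
  when \<open>K > 0\<close>. Only even powers of r occur, hence the variable t.\<close>

definition warp_ratio :: "real \<Rightarrow> real \<Rightarrow> real" where
  "warp_ratio K t = (\<Sum>n. (- K) ^ n / fact (2 * n + 1) * t ^ n)"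

text \<open>With t = r^2 this is the derivative h'(r): a cosine, the constant 1 or a hyperbolic
  cosine, according to the sign of \<open>K\<close>.\<close>

definition warp_cos :: "real \<Rightarrow> real \<Rightarrow> real" where
  "warp_cos K t = (\<Sum>n. (- K) ^ n / fact (2 * n) * t ^ n)"

lemma summable_fact_majorant:
  fixes K t :: real
  assumes "\<And>n. n \<le> d n"
  shows "summable (\<lambda>n. (- K) ^ n / fact (d n) * t ^ n)"
proof (rule summable_comparison_test')
  show "summable (\<lambda>n. inverse (fact n) * \<bar>K * t\<bar> ^ n)"
    by (rule summable_exp)
  fix n :: nat
  have "norm ((- K) ^ n / fact (d n) * t ^ n) = inverse (fact (d n)) * \<bar>K * t\<bar> ^ n"
    by (simp add: norm_mult norm_divide norm_power abs_mult power_mult_distrib divide_inverse power_abs)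
  also have "\<dots> \<le> inverse (fact n) * \<bar>K * t\<bar> ^ n"
    by (intro mult_right_mono le_imp_inverse_le fact_mono assms) auto
  finally show "norm ((- K) ^ n / fact (d n) * t ^ n) \<le> inverse (fact n) * \<bar>K * t\<bar> ^ n" .
qed

lemma summable_warp_ratio: "summable (\<lambda>n. (- K) ^ n / fact (2 * n + 1) * t ^ n)" for K t :: real
  by (rule summable_fact_majorant) simp

lemma summable_warp_cos: "summable (\<lambda>n. (- K) ^ n / fact (2 * n) * t ^ n)" for K t :: real
  by (rule summable_fact_majorant) simp

text \<open>The equation h'' = - K h in the variable t = r^2, where d/dr = 2 r d/dt.\<close>

lemma warp_cos_derivative:
  "(warp_cos K has_real_derivative - (K / 2) * warp_ratio K t) (at t)"
proof -
  have eq: "diffs (\<lambda>n. (- K) ^ n / fact (2 * n)) n = - (K / 2) * ((- K) ^ n / fact (2 * n + 1))" for n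
  proof -
    define F :: real where "F = fact (2 * n + 1)"
    have F: "F \<noteq> 0" "fact (2 * Suc n) = 2 * (1 + real n) * F"
      unfolding F_def by (rule fact_nonzero) (simp add: algebra_simps)
    have "(1 + real n) * (K * (- K) ^ n / (2 * (1 + real n) * F)) = K * (- K) ^ n / (2 * F)"
      by (simp add: divide_simps F)
    then show ?thesis
      unfolding diffs_def F(2) F_def[symmetric] by simp
  qed
  have "(\<Sum>n. diffs (\<lambda>n. (- K) ^ n / fact (2 * n)) n * t ^ n)
    = (\<Sum>n. - (K / 2) * ((- K) ^ n / fact (2 * n + 1) * t ^ n))"
    unfolding eq by (simp only: mult.assoc)
  also have "\<dots> = - (K / 2) * warp_ratio K t"
    unfolding warp_ratio_def by (rule suminf_mult[OF summable_warp_ratio])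
  finally show ?thesis
    using entire_series_derivative(1)[OF summable_warp_cos, of K t]
    by (simp add: warp_cos_def[abs_def])
qed

definition warp_ratio_deriv :: "real \<Rightarrow> real \<Rightarrow> real" where
  "warp_ratio_deriv K t = (\<Sum>n. diffs (\<lambda>n. (- K) ^ n / fact (2 * n + 1)) n * t ^ n)"

lemma warp_ratio_derivative:
  "(warp_ratio K has_real_derivative warp_ratio_deriv K t) (at t)"
  unfolding warp_ratio_deriv_def warp_ratio_def[abs_def]
  by (rule entire_series_derivative[OF summable_warp_ratio])

text \<open>Differentiating h(r) = r S(r^2) gives h' = S + 2 r^2 S'. On coefficients it is (2n + 1)
  / (2n + 1)! = 1 / (2n)!. Keeping the factor \<open>t\<close> on the left makes it valid at the
  pole too.\<close>

lemma warp_ratio_ode: "2 * t * warp_ratio_deriv K t = warp_cos K t - warp_ratio K t"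
proof -
  let ?a = "\<lambda>n. (- K) ^ n / fact (2 * n + 1)"
  have sd: "summable (\<lambda>n. diffs ?a n * t ^ n)"
    using entire_series_derivative(2)[OF summable_warp_ratio] .
  have "(\<lambda>n. of_nat n * ?a n * t ^ (n - Suc 0)) sums warp_ratio_deriv K t"
    unfolding warp_ratio_deriv_def by (rule diffs_equiv[OF sd])
  then have "(\<lambda>n. 2 * t * (of_nat n * ?a n * t ^ (n - Suc 0))) sums (2 * t * warp_ratio_deriv K t)"
    by (rule sums_mult)
  moreover have "(\<lambda>n. ?a n * t ^ n) sums warp_ratio K t"
    unfolding warp_ratio_def by (rule summable_sums[OF summable_warp_ratio])
  ultimately have "(\<lambda>n. 2 * t * (of_nat n * ?a n * t ^ (n - Suc 0)) + ?a n * t ^ n) sums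
      (2 * t * warp_ratio_deriv K t + warp_ratio K t)"
    by (rule sums_add)
  moreover have "2 * t * (of_nat n * ?a n * t ^ (n - Suc 0)) + ?a n * t ^ n = (- K) ^ n / fact (2 * n) * t ^ n" for n
  proof -
    \<comment> \<open>For \<open>n = 0\<close> the truncated exponent \<open>n - Suc 0\<close> does
      no harm, since the factor \<open>of_nat n\<close> vanishes.\<close>
    have n: "t * (of_nat n * t ^ (n - Suc 0)) = of_nat n * t ^ n"
      by (cases n) auto
    have "2 * t * (of_nat n * A * t ^ (n - Suc 0)) + A * t ^ n
        = 2 * A * (t * (of_nat n * t ^ (n - Suc 0))) + A * t ^ n" for A
      by (simp only: mult_ac)
    then have "2 * t * (of_nat n * A * t ^ (n - Suc 0)) + A * t ^ n = (2 * of_nat n + 1) * A * t ^ n" for A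
      unfolding n by (simp add: algebra_simps)
    then have "2 * t * (of_nat n * ?a n * t ^ (n - Suc 0)) + ?a n * t ^ n = (2 * of_nat n + 1) * ?a n * t ^ n" .
    also have "(2 * of_nat n + 1) * ?a n = (- K) ^ n / fact (2 * n)"
    proof -
      have F: "fact (2 * n + 1) = (2 * real n + 1) * fact (2 * n)"
        by (simp add: algebra_simps)
      have "2 * real n + 1 \<noteq> 0" by linarith
      then show ?thesis unfolding F unfolding times_divide_eq_right by (rule nonzero_mult_divide_mult_cancel_left)
    qed
    finally show ?thesis .
  qed
  ultimately have "(\<lambda>n. (- K) ^ n / fact (2 * n) * t ^ n) sums (2 * t * warp_ratio_deriv K t + warp_ratio K t)"
    by simp
  then show ?thesis
    unfolding warp_cos_def using sums_unique by fastforce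
qed

lemma warp_ratio_0 [simp]: "warp_ratio K 0 = 1"
  unfolding warp_ratio_def by (subst powser_zero) auto

lemma warp_cos_0 [simp]: "warp_cos K 0 = 1"
  unfolding warp_cos_def by (subst powser_zero) auto

text \<open>The first integral h'^2 + K h^2 = 1 of h'' = - K h: the left side has derivative 0 and
  equals 1 at the pole.\<close>

lemma warp_pythagoras: "(warp_cos K t)\<^sup>2 + K * t * (warp_ratio K t)\<^sup>2 = 1"
proof -
  let ?E = "\<lambda>t. (warp_cos K t)\<^sup>2 + K * t * (warp_ratio K t)\<^sup>2"
  have "(?E has_real_derivative 0) (at s)" for s
  proof -
    have "(?E has_real_derivative
        2 * warp_cos K s * (- (K / 2) * warp_ratio K s)
        + (K * (warp_ratio K s)\<^sup>2 + K * warp_ratio K s * (2 * s * warp_ratio_deriv K s))) (at s)"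
      by (rule derivative_eq_intros warp_cos_derivative warp_ratio_derivative refl)+
         (simp add: algebra_simps power2_eq_square)
    then show ?thesis
      unfolding warp_ratio_ode by (simp add: algebra_simps power2_eq_square)
  qed
  then have "?E t = ?E 0"
    by (rule DERIV_isconst_all[rule_format])
  then show ?thesis by simp
qed

text \<open>Even and odd part of the exponential series: every other term of the combined series is
  zero, and grouping the terms in pairs removes it.\<close>

lemma sinh_cosh_series:
  fixes x :: real
  shows cosh_paired: "(\<lambda>n. x ^ (2 * n) / fact (2 * n)) sums cosh x"
    and sinh_paired: "(\<lambda>n. x ^ (2 * n + 1) / fact (2 * n + 1)) sums sinh x"
proof -
  have e: "(\<lambda>n. y ^ n / fact n) sums exp y" for y :: real
    using exp_converges[of y] by (simp add: divide_inverse mult.commute)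
  have "(\<lambda>n. (x ^ n / fact n + (- x) ^ n / fact n) / 2) sums cosh x"
    unfolding cosh_field_def by (intro sums_divide sums_add e)
  from sums_group[OF this, of 2]
  have "(\<lambda>n. \<Sum>k = n*2..<n * 2 + 2. (x ^ k / fact k + (- x) ^ k / fact k) / 2) sums cosh x" by simp
  then show "(\<lambda>n. x ^ (2 * n) / fact (2 * n)) sums cosh x"
    by (simp add: ac_simps)
  have "(\<lambda>n. (x ^ n / fact n - (- x) ^ n / fact n) / 2) sums sinh x"
    unfolding sinh_field_def by (intro sums_divide sums_diff e)
  from sums_group[OF this, of 2]
  have "(\<lambda>n. \<Sum>k = n*2..<n * 2 + 2. (x ^ k / fact k - (- x) ^ k / fact k) / 2) sums sinh x" by simp
  then show "(\<lambda>n. x ^ (2 * n + 1) / fact (2 * n + 1)) sums sinh x"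
    by (simp add: ac_simps)
qed

text \<open>This bridge allows \<open>warp\<close> to be differentiated without a case distinction
  on the sign of \<open>K\<close>.\<close>

lemma warp_eq: "warp K r = r * warp_ratio K (r\<^sup>2)"
proof -
  consider "K > 0" | "K = 0" | "K < 0" by linarith
  then show ?thesis
  proof cases
    case 1
    define q where "q = sqrt K"
    have q: "q > 0" "K = q\<^sup>2" using 1 by (auto simp: q_def)
    have eq: "(- 1) ^ n / fact (2 * n + 1) * (q * r) ^ (2 * n + 1)
        = q * r * ((- K) ^ n / fact (2 * n + 1) * (r\<^sup>2) ^ n)" for n
      unfolding q(2) power_minus[of "q\<^sup>2"] by (simp add: power_mult power_mult_distrib power_add)
    have "(\<lambda>n. q * r * ((- K) ^ n / fact (2 * n + 1) * (r\<^sup>2) ^ n)) sums sin (q * r)"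
      using sin_paired[of "q * r"] unfolding eq .
    moreover have "(\<lambda>n. q * r * ((- K) ^ n / fact (2 * n + 1) * (r\<^sup>2) ^ n)) sums (q * r * warp_ratio K (r\<^sup>2))"
      unfolding warp_ratio_def by (intro sums_mult summable_sums summable_warp_ratio)
    ultimately have "sin (q * r) = q * r * warp_ratio K (r\<^sup>2)" by (rule sums_unique2)
    then show ?thesis using 1 q by (simp add: warp_def flip: q_def)
  next
    case 2
    have "warp_ratio K s = 1" for s
      unfolding warp_ratio_def 2
      by (subst suminf_finite[of "{0}"]) auto
    then show ?thesis using 2 by (simp add: warp_def)
  next
    case 3
    define q where "q = sqrt (- K)"
    have q: "q > 0" "- K = q\<^sup>2" using 3 by (auto simp: q_def)
    have eq: "(q * r) ^ (2 * n + 1) / fact (2 * n + 1)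
        = q * r * ((- K) ^ n / fact (2 * n + 1) * (r\<^sup>2) ^ n)" for n
      unfolding q(2) by (simp add: power_mult power_mult_distrib power_add)
    have "(\<lambda>n. q * r * ((- K) ^ n / fact (2 * n + 1) * (r\<^sup>2) ^ n)) sums sinh (q * r)"
      using sinh_paired[of "q * r"] unfolding eq .
    moreover have "(\<lambda>n. q * r * ((- K) ^ n / fact (2 * n + 1) * (r\<^sup>2) ^ n)) sums (q * r * warp_ratio K (r\<^sup>2))"
      unfolding warp_ratio_def by (intro sums_mult summable_sums summable_warp_ratio)
    ultimately have "sinh (q * r) = q * r * warp_ratio K (r\<^sup>2)" by (rule sums_unique2)
    then show ?thesis using 3 q by (simp add: warp_def flip: q_def)
  qed
qed

lemma warp_cos_eq:
  "warp_cos K (r\<^sup>2) = (if K > 0 then cos (sqrt K * r) else if K = 0 then 1 else cosh (sqrt (- K) * r))"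
proof -
  consider "K > 0" | "K = 0" | "K < 0" by linarith
  then show ?thesis
  proof cases
    case 1
    define q where "q = sqrt K"
    have q: "K = q\<^sup>2" using 1 by (auto simp: q_def)
    have eq: "(- 1) ^ n / fact (2 * n) * (q * r) ^ (2 * n) = (- K) ^ n / fact (2 * n) * (r\<^sup>2) ^ n" for n
      unfolding q power_minus[of "q\<^sup>2"] by (simp add: power_mult power_mult_distrib)
    show ?thesis
      unfolding warp_cos_def using cos_paired[of "q * r"] 1 unfolding eq
      by (simp add: q_def sums_iff)
  next
    case 2
    have "warp_cos K s = 1" for s
      unfolding warp_cos_def 2
      by (subst suminf_finite[of "{0}"]) auto
    then show ?thesis using 2 by simp
  next
    case 3
    define q where "q = sqrt (- K)"
    have q: "- K = q\<^sup>2" using 3 by (auto simp: q_def)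
    have eq: "(q * r) ^ (2 * n) / fact (2 * n) = (- K) ^ n / fact (2 * n) * (r\<^sup>2) ^ n" for n
      unfolding q by (simp add: power_mult power_mult_distrib)
    show ?thesis
      unfolding warp_cos_def using cosh_paired[of "q * r"] 3 unfolding eq
      by (simp add: q_def sums_iff)
  qed
qed

text \<open>An open set that contains every admissible closed disk of curvature \<open>K\<close>, so
  it can serve as the neighbourhood in \<open>steklov_eigenvalue\<close>. The first condition makes
  the metric nondegenerate, the second keeps the denominator of the stereographic coordinate
  positive.\<close>

definition warp_domain :: "real \<Rightarrow> (real^2) set" where
  "warp_domain K = {x. warp_ratio K (x \<bullet> x) > 0 \<and> 1 + warp_cos K (x \<bullet> x) > 0}"

lemma continuous_on_warp_ratio: "continuous_on A (warp_ratio K)"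
  by (meson warp_ratio_derivative DERIV_isCont continuous_at_imp_continuous_on)

lemma continuous_on_warp_cos: "continuous_on A (warp_cos K)"
  by (meson warp_cos_derivative DERIV_isCont continuous_at_imp_continuous_on)

lemma open_warp_domain: "open (warp_domain K)"
  unfolding warp_domain_def Collect_conj_eq
  by (intro open_Int open_Collect_less continuous_intros
      continuous_on_compose2[OF continuous_on_warp_ratio]
      continuous_on_compose2[OF continuous_on_warp_cos]) auto

lemma admissible_angle:
  assumes "admissible_radius K R" "0 \<le> r" "r \<le> R" "K > 0"
  shows "0 \<le> sqrt K * r" "sqrt K * r < pi"
proof -
  have "sqrt K * r \<le> sqrt K * R" using assms by (intro mult_left_mono) auto
  also have "\<dots> < pi" using assms by (simp add: admissible_radius_def field_simps)
  finally show "sqrt K * r < pi" .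
qed (use assms in auto)

lemma warp_pos:
  assumes "admissible_radius K R" "0 < r" "r \<le> R"
  shows "warp K r > 0"
  using assms admissible_angle[of K R r] by (auto simp: warp_def intro!: divide_pos_pos sin_gt_zero)

lemma cball_subset_warp_domain:
  assumes "admissible_radius K R"
  shows "cball 0 R \<subseteq> warp_domain K"
proof
  fix x :: "real^2" assume "x \<in> cball 0 R"
  then have r: "norm x \<le> R" by simp
  have xx: "x \<bullet> x = (norm x)\<^sup>2" by (simp add: dot_square_norm)
  have "warp_ratio K (x \<bullet> x) > 0"
  proof (cases "x = 0")
    case False
    then show ?thesis
      using warp_pos[OF assms _ r] unfolding warp_eq xx by (simp add: zero_less_mult_iff)
  qed simp
  moreover have "1 + warp_cos K (x \<bullet> x) > 0"
  proof (cases "K > 0")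
    case True
    have "cos pi < cos (sqrt K * norm x)"
      using admissible_angle[OF assms _ r True] by (intro cos_monotone_0_pi) auto
    then show ?thesis using True by (simp add: xx warp_cos_eq)
  next
    case False
    then show ?thesis using cosh_real_pos[of "sqrt (-K) * norm x"] by (auto simp: xx warp_cos_eq add_pos_pos)
  qed
  ultimately show "x \<in> warp_domain K" by (simp add: warp_domain_def)
qed

lemma warp_domainD:
  assumes "x \<in> warp_domain K"
  shows "warp_ratio K (x \<bullet> x) > 0" "1 + warp_cos K (x \<bullet> x) > 0"
  using assms by (auto simp: warp_domain_def)

section \<open>The Laplacian of the space form in polar form\<close>

lemma inner_2: "x \<bullet> y = x $ 1 * y $ 1 + x $ 2 * y $ 2" for x y :: "real^2"
  by (simp add: inner_vec_def sum_2)

lemma smooth_on_has_derivative_2: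
  fixes f :: "real^2 \<Rightarrow> real"
  assumes "smooth_on U f" "x \<in> U"
  shows "(f has_derivative (\<lambda>h. h $ 1 * partial 1 f x + h $ 2 * partial 2 f x)) (at x)"
  using smooth_on_has_derivative[OF assms] by (simp add: sum_2)

lemma has_derivative_nth [derivative_intros]:
  "((\<lambda>x. x $ i) has_derivative (\<lambda>h. h $ i)) (at x within A)" for x :: "real^'n::finite"
  by (rule bounded_linear_imp_has_derivative[OF bounded_linear_vec_nth])

lemma partial_add:
  assumes "smooth_on U f" "smooth_on U g" "x \<in> U"
  shows "partial i (\<lambda>x. f x + g x) x = partial i f x + partial i g x"
  using partial_eqI[OF has_derivative_add[OF smooth_on_has_derivative[OF assms(1,3)]
        smooth_on_has_derivative[OF assms(2,3)]]]
  by (simp add: sum_axis_mult)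

lemma partial_diff:
  assumes "smooth_on U f" "smooth_on U g" "x \<in> U"
  shows "partial i (\<lambda>x. f x - g x) x = partial i f x - partial i g x"
  using partial_eqI[OF has_derivative_diff[OF smooth_on_has_derivative[OF assms(1,3)]
        smooth_on_has_derivative[OF assms(2,3)]]]
  by (simp add: sum_axis_mult)

lemma partial_mult:
  assumes "smooth_on U f" "smooth_on U g" "x \<in> U"
  shows "partial i (\<lambda>x. f x * g x) x = f x * partial i g x + partial i f x * g x"
  using partial_eqI[OF has_derivative_mult[OF smooth_on_has_derivative[OF assms(1,3)]
        smooth_on_has_derivative[OF assms(2,3)]]]
  by (simp add: sum_axis_mult)

lemma partial_const [simp]: "partial i (\<lambda>x. c) = (\<lambda>x. 0)"
  by (simp add: partial_def fun_eq_iff)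

lemma partial_minus:
  assumes "smooth_on U f" "x \<in> U"
  shows "partial i (\<lambda>x. - f x) x = - partial i f x"
  using partial_diff[OF smooth_on_const[OF smooth_on_open[OF assms(1)], of 0] assms, of i] by simp

text \<open>The Euler field r d/dr. The factor r makes its coefficients polynomial, so it preserves
  smoothness at the pole and can be iterated there.\<close>

definition radial :: "(real^2 \<Rightarrow> real) \<Rightarrow> real^2 \<Rightarrow> real" where
  "radial f x = x $ 1 * partial 1 f x + x $ 2 * partial 2 f x"

text \<open>The rotation field d/d\<theta>.\<close>

definition angular :: "(real^2 \<Rightarrow> real) \<Rightarrow> real^2 \<Rightarrow> real" where
  "angular f x = x $ 1 * partial 2 f x - x $ 2 * partial 1 f x"

lemma smooth_on_radial: "smooth_on U f \<Longrightarrow> smooth_on U (radial f)"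
  unfolding radial_def[abs_def]
  by (intro smooth_on_add smooth_on_mult smooth_on_nth smooth_on_partial smooth_on_open)

lemma smooth_on_angular: "smooth_on U f \<Longrightarrow> smooth_on U (angular f)"
  unfolding angular_def[abs_def]
  by (intro smooth_on_diff smooth_on_mult smooth_on_nth smooth_on_partial smooth_on_open)

text \<open>Because h = r S, the factor h^2 cancels two of the four powers of r in the denominator
  of the angular term, and both terms get the denominator \<open>x \<bullet> x\<close>.\<close>

lemma space_form_metric_nth:
  assumes "x \<noteq> 0"
  shows "space_form_metric K x $ i $ j = (x $ i * x $ j + (warp_ratio K (x \<bullet> x))\<^sup>2 *
    ((if i = 1 then - x $ 2 else x $ 1) * (if j = 1 then - x $ 2 else x $ 1))) / (x \<bullet> x)"
proof -
  have n: "norm x \<noteq> 0" using assms by simp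
  have xx: "x \<bullet> x = (norm x)\<^sup>2" by (simp add: dot_square_norm)
  have v: "vector [- (x $ 2), x $ 1] $ k = (if k = 1 then - x $ 2 else x $ 1)" for k :: 2
    using exhaust_2[of k] by auto
  show ?thesis
    using assms n unfolding space_form_metric_def warp_eq xx dr_def dtheta_def
    by (simp add: v power2_eq_square divide_simps)
qed

lemma matrix_inv_eqI:
  fixes A B :: "real^'n::finite^'n"
  assumes "A ** B = mat 1"
  shows "matrix_inv A = B"
proof -
  have BA: "B ** A = mat 1" using assms by (simp add: matrix_left_right_inverse)
  then have "invertible A" using assms by (auto simp: invertible_def)
  then have "A ** matrix_inv A = mat 1"
    unfolding invertible_def matrix_inv_def by (rule someI2_ex) simp
  then have "B ** (A ** matrix_inv A) = B" by simp
  then show ?thesis by (simp add: matrix_mul_assoc BA)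
qed

lemma matrix_inv_2:
  fixes A :: "real^2^2"
  assumes "det A \<noteq> 0"
  shows "matrix_inv A $ 1 $ 1 = A $ 2 $ 2 / det A" "matrix_inv A $ 1 $ 2 = - A $ 1 $ 2 / det A"
    "matrix_inv A $ 2 $ 1 = - A $ 2 $ 1 / det A" "matrix_inv A $ 2 $ 2 = A $ 1 $ 1 / det A"
proof -
  define B :: "real^2^2" where "B = vector [vector [A $ 2 $ 2 / det A, - A $ 1 $ 2 / det A],
    vector [- A $ 2 $ 1 / det A, A $ 1 $ 1 / det A]]"
  have "A ** B = mat 1"
    using assms unfolding B_def
    by (simp add: vec_eq_iff forall_2 matrix_matrix_mult_def sum_2 mat_def divide_simps)
       (simp add: det_2)
  then have "matrix_inv A = B" by (rule matrix_inv_eqI)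
  then show "matrix_inv A $ 1 $ 1 = A $ 2 $ 2 / det A" "matrix_inv A $ 1 $ 2 = - A $ 1 $ 2 / det A"
    "matrix_inv A $ 2 $ 1 = - A $ 2 $ 1 / det A" "matrix_inv A $ 2 $ 2 = A $ 1 $ 1 / det A"
    by (simp_all add: B_def)
qed

text \<open>Away from the pole, \<open>x\<close> and its rotation by a right angle are eigenvectors
  of the metric matrix with eigenvalues 1 and S^2; at the pole the matrix is the identity and S =
  1.\<close>

lemma det_space_form_metric: "det (space_form_metric K x) = (warp_ratio K (x \<bullet> x))\<^sup>2"
proof (cases "x = 0")
  case True
  then show ?thesis by (simp add: space_form_metric_def)
next
  case False
  then have t: "x \<bullet> x \<noteq> 0" by simp
  define S where "S = warp_ratio K (x \<bullet> x)"
  have "det (space_form_metric K x) = S\<^sup>2 * (x $ 1 * x $ 1 + x $ 2 * x $ 2)\<^sup>2 / (x \<bullet> x)\<^sup>2"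
    unfolding det_2 space_form_metric_nth[OF False] S_def[symmetric]
    by (simp add: divide_simps t) (simp add: algebra_simps power2_eq_square)
  then show ?thesis using t by (simp add: inner_2 S_def)
qed

text \<open>The vector field \<open>sqrt (det g)\<close> g^(-1) du, whose coordinate divergence is
  \<open>sqrt (det g)\<close> times the Laplacian. Up to a rotation it is the Hodge dual of du, so
  equations between \<open>flux K u\<close> and the derivatives of another function are
  Cauchy-Riemann equations.\<close>

definition flux :: "real \<Rightarrow> (real^2 \<Rightarrow> real) \<Rightarrow> 2 \<Rightarrow> real^2 \<Rightarrow> real" where
  "flux K u i x = sqrt (det (space_form_metric K x)) *
     (\<Sum>j\<in>UNIV. matrix_inv (space_form_metric K x) $ i $ j * partial j u x)"

lemma laplace_beltrami_flux:
  "laplace_beltrami (space_form_metric K) u x =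
    (partial 1 (flux K u 1) x + partial 2 (flux K u 2) x) / sqrt (det (space_form_metric K x))"
  unfolding laplace_beltrami_def flux_def[abs_def] by (simp add: sum_2)

lemma matrix_inv_mat_1: "matrix_inv (mat 1 :: real^'n::finite^'n) = mat 1"
  by (rule matrix_inv_eqI) simp

lemma flux_0: "flux K u i 0 = partial i u 0"
proof -
  have "(mat 1 :: real^2^2) $ i $ j = (if i = j then 1 else 0)" for i j
    by (simp add: mat_def)
  then show ?thesis
    using exhaust_2[of i]
    by (auto simp: flux_def space_form_metric_def matrix_inv_mat_1 sum_2)
qed

text \<open>The inverse metric has eigenvalues 1 and S^(-2) on \<open>x\<close> and on its rotation.
  Multiplied by \<open>sqrt (det g)\<close>, which is S, they become S on the radial part and 1/S on
  the angular part of du.\<close>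

lemma flux_eq:
  assumes "x \<noteq> 0" and S: "warp_ratio K (x \<bullet> x) > 0"
  shows "flux K u 1 x = (warp_ratio K (x \<bullet> x) * x $ 1 * radial u x
      - x $ 2 * angular u x / warp_ratio K (x \<bullet> x)) / (x \<bullet> x)"
    and "flux K u 2 x = (warp_ratio K (x \<bullet> x) * x $ 2 * radial u x
      + x $ 1 * angular u x / warp_ratio K (x \<bullet> x)) / (x \<bullet> x)"
proof -
  define S where "S = warp_ratio K (x \<bullet> x)"
  have t: "x \<bullet> x \<noteq> 0" using assms by simp
  have S0: "S > 0" using S by (simp add: S_def)
  have d: "det (space_form_metric K x) = S\<^sup>2" "sqrt (S\<^sup>2) = S" "det (space_form_metric K x) \<noteq> 0"
    using S0 by (simp_all add: det_space_form_metric S_def)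
  have g: "space_form_metric K x $ 1 $ 1 = ((x $ 1)\<^sup>2 + S\<^sup>2 * (x $ 2)\<^sup>2) / (x \<bullet> x)"
    "space_form_metric K x $ 1 $ 2 = (1 - S\<^sup>2) * x $ 1 * x $ 2 / (x \<bullet> x)"
    "space_form_metric K x $ 2 $ 1 = (1 - S\<^sup>2) * x $ 1 * x $ 2 / (x \<bullet> x)"
    "space_form_metric K x $ 2 $ 2 = ((x $ 2)\<^sup>2 + S\<^sup>2 * (x $ 1)\<^sup>2) / (x \<bullet> x)"
    unfolding space_form_metric_nth[OF assms(1)] S_def[symmetric]
    by (simp_all add: algebra_simps power2_eq_square)
  show "flux K u 1 x = (warp_ratio K (x \<bullet> x) * x $ 1 * radial u x
      - x $ 2 * angular u x / warp_ratio K (x \<bullet> x)) / (x \<bullet> x)"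
    unfolding flux_def sum_2 matrix_inv_2[OF d(3)] unfolding d g unfolding d S_def[symmetric] radial_def angular_def
    using t S0 by (simp add: divide_simps) (simp add: algebra_simps power2_eq_square)
  show "flux K u 2 x = (warp_ratio K (x \<bullet> x) * x $ 2 * radial u x
      + x $ 1 * angular u x / warp_ratio K (x \<bullet> x)) / (x \<bullet> x)"
    unfolding flux_def sum_2 matrix_inv_2[OF d(3)] unfolding d g unfolding d S_def[symmetric] radial_def angular_def
    using t S0 by (simp add: divide_simps) (simp add: algebra_simps power2_eq_square)
qed

lemma has_derivative_compose_dot:
  assumes "(f has_real_derivative D) (at (x \<bullet> x))"
  shows "((\<lambda>y. f (y \<bullet> y)) has_derivative (\<lambda>h. D * (2 * (x \<bullet> h)))) (at x)"
proof -
  have "((\<lambda>y. y \<bullet> y) has_derivative (\<lambda>h. 2 * (x \<bullet> h))) (at x)"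
    by (auto intro!: derivative_eq_intros simp: inner_commute)
  from has_derivative_compose[OF this assms[unfolded has_field_derivative_def]]
  show ?thesis .
qed

text \<open>This is the Laplacian (1/h) d/dr (h du/dr) + h^(-2) d^2u/d\<theta>^2, multiplied by h^2
  = S^2 r^2, with h du/dr = S \<open>radial u\<close>.\<close>

lemma laplace_beltrami_polar:
  assumes u: "smooth_on U u" and x: "x \<in> U" "x \<in> warp_domain K" "x \<noteq> 0"
  defines "S \<equiv> warp_ratio K (x \<bullet> x)"
  shows "laplace_beltrami (space_form_metric K) u x * (S\<^sup>2 * (x \<bullet> x)) =
    S\<^sup>2 * radial (radial u) x + 2 * (x \<bullet> x) * warp_ratio_deriv K (x \<bullet> x) * S * radial u x
      + angular (angular u) x"
proof -
  let ?V = "U \<inter> warp_domain K - {0}"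
  have V: "open ?V" "x \<in> ?V"
    using smooth_on_open[OF u] open_warp_domain x by auto
  define t where "t = x \<bullet> x"
  define D where "D = warp_ratio_deriv K t"
  define \<alpha> where "\<alpha> y = warp_ratio K (y \<bullet> y) / (y \<bullet> y)" for y :: "real^2"
  define \<beta> where "\<beta> y = 1 / (warp_ratio K (y \<bullet> y) * (y \<bullet> y))" for y :: "real^2"
  have S0: "S > 0" using warp_domainD(1)[OF x(2)] by (simp add: S_def)
  have t: "t \<noteq> 0" using x(3) by (simp add: t_def)
  have S_t: "warp_ratio K t = S" by (simp add: S_def t_def)
  \<comment> \<open>\<open>a\<close> and \<open>b\<close> are the derivatives of S/t and of 1/(S t)
    with respect to t = r^2.\<close>
  define a where "a = (D * t - S) / t\<^sup>2"
  define b where "b = - (D * t + S) / (S * t)\<^sup>2"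
  have "((\<lambda>r. warp_ratio K r / r) has_real_derivative a) (at t)"
    unfolding a_def D_def S_def t_def[symmetric]
    by (rule derivative_eq_intros warp_ratio_derivative refl t)+ (simp add: power2_eq_square)
  from has_derivative_compose_dot[OF this[unfolded t_def]]
  have d\<alpha>: "(\<alpha> has_derivative (\<lambda>h. a * (2 * (x $ 1 * h $ 1 + x $ 2 * h $ 2)))) (at x)"
    unfolding \<alpha>_def[abs_def] inner_2[of x] by (simp add: mult_ac)
  have St: "warp_ratio K t * t \<noteq> 0" using S0 t by (simp add: S_def t_def)
  have "((\<lambda>r. 1 / (warp_ratio K r * r)) has_real_derivative b) (at t)"
    unfolding b_def D_def S_def t_def[symmetric]
    by (rule derivative_eq_intros warp_ratio_derivative refl St)+ (simp add: power2_eq_square)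
  from has_derivative_compose_dot[OF this[unfolded t_def]]
  have d\<beta>: "(\<beta> has_derivative (\<lambda>h. b * (2 * (x $ 1 * h $ 1 + x $ 2 * h $ 2)))) (at x)"
    unfolding \<beta>_def[abs_def] inner_2[of x] by (simp add: mult_ac)
  note dw = smooth_on_has_derivative_2[OF smooth_on_radial[OF u] x(1)]
  note da = smooth_on_has_derivative_2[OF smooth_on_angular[OF u] x(1)]
  have "partial 1 (flux K u 1) x
      = partial 1 (\<lambda>y. \<alpha> y * (y $ 1 * radial u y) - \<beta> y * (y $ 2 * angular u y)) x"
    using warp_domainD(1) by (intro partial_cong_open[OF V])
      (auto simp: flux_eq \<alpha>_def \<beta>_def diff_divide_distrib mult_ac)
  also have "\<dots> = \<alpha> x * (x $ 1 * partial 1 (radial u) x + radial u x) + 2 * a * x $ 1 * (x $ 1 * radial u x)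
      - (\<beta> x * (x $ 2 * partial 1 (angular u) x) + 2 * b * x $ 1 * (x $ 2 * angular u x))"
    by (rule partial_eqI[THEN trans],
        (rule has_derivative_diff has_derivative_mult d\<alpha> d\<beta> has_derivative_nth dw da)+)
       (simp add: axis_def)
  finally have 1: "partial 1 (flux K u 1) x = \<dots>" .
  have "partial 2 (flux K u 2) x
      = partial 2 (\<lambda>y. \<alpha> y * (y $ 2 * radial u y) + \<beta> y * (y $ 1 * angular u y)) x"
    using warp_domainD(1) by (intro partial_cong_open[OF V])
      (auto simp: flux_eq \<alpha>_def \<beta>_def add_divide_distrib mult_ac)
  also have "\<dots> = \<alpha> x * (x $ 2 * partial 2 (radial u) x + radial u x) + 2 * a * x $ 2 * (x $ 2 * radial u x)
      + (\<beta> x * (x $ 1 * partial 2 (angular u) x) + 2 * b * x $ 2 * (x $ 1 * angular u x))"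
    by (rule partial_eqI[THEN trans],
        (rule has_derivative_add has_derivative_mult d\<alpha> d\<beta> has_derivative_nth dw da)+)
       (simp add: axis_def)
  finally have 2: "partial 2 (flux K u 2) x = \<dots>" .
  have d: "sqrt (det (space_form_metric K x)) = S"
    using S0 by (simp add: det_space_form_metric S_def)
  \<comment> \<open>The terms with \<open>b\<close> cancel: \<beta> is constant on circles, and the
    angular field is tangent to them.\<close>
  have "partial 1 (flux K u 1) x + partial 2 (flux K u 2) x =
    \<alpha> x * (2 * radial u x + radial (radial u) x) + 2 * a * t * radial u x + \<beta> x * angular (angular u) x"
    unfolding 1 2 radial_def[of "radial u"] angular_def[of "angular u"] t_def inner_2
    by (simp add: algebra_simps)
  also have "2 * a * t = 2 * D - 2 * \<alpha> x"
    using t by (simp add: a_def \<alpha>_def divide_simps power2_eq_square S_t flip: t_def)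
  finally have "partial 1 (flux K u 1) x + partial 2 (flux K u 2) x =
    \<alpha> x * radial (radial u) x + 2 * D * radial u x + \<beta> x * angular (angular u) x"
    by (simp add: algebra_simps)
  then show ?thesis
    unfolding laplace_beltrami_flux d \<alpha>_def \<beta>_def
    using S0 t by (simp add: divide_simps power2_eq_square D_def S_t flip: t_def) (simp add: algebra_simps)
qed

text \<open>The metric is diagonal in the frame of \<open>x\<close> and its rotation and is
  Euclidean in the direction of \<open>x\<close>, so the unit normal is the Euclidean one.\<close>

lemma outward_unit_normal_space_form:
  assumes R: "admissible_radius K R" and x: "norm x = R"
  shows "outward_unit_normal (space_form_metric K) x = (1 / R) *\<^sub>R x"
proof -
  have R0: "R > 0" using R by (simp add: admissible_radius_def)
  then have x0: "x \<noteq> 0" using x by auto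
  define S where "S = warp_ratio K (x \<bullet> x)"
  define t where "t = x \<bullet> x"
  have t: "t > 0" "t = R\<^sup>2" using x0 x by (auto simp: t_def dot_square_norm)
  have "x \<in> warp_domain K" using cball_subset_warp_domain[OF R] x by auto
  then have S: "S > 0" using warp_domainD by (simp add: S_def)
  have g: "v \<bullet> (space_form_metric K x *v w) =
    ((x \<bullet> v) * (x \<bullet> w) + S\<^sup>2 * (x $ 1 * v $ 2 - x $ 2 * v $ 1) * (x $ 1 * w $ 2 - x $ 2 * w $ 1)) / t" for v w
    using t(1) by (simp add: inner_2[of v] inner_2[of x v] inner_2[of x w] matrix_vector_mult_def sum_2
        space_form_metric_nth[OF x0, of K, folded S_def, folded t_def] divide_simps) (simp add: algebra_simps)
  have t2: "x $ 1 * x $ 1 + x $ 2 * x $ 2 = t" by (simp add: t_def inner_2)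
  show ?thesis
    unfolding outward_unit_normal_def g
  proof (rule the_equality, intro conjI allI impI)
    let ?n = "(1 / R) *\<^sub>R x"
    have "x \<bullet> ?n = R" using t R0 by (simp add: t_def[symmetric] power2_eq_square)
    moreover have "x $ 1 * ?n $ 2 - x $ 2 * ?n $ 1 = 0" by simp
    ultimately show "(x \<bullet> ?n * (x \<bullet> ?n) + S\<^sup>2 * (x $ 1 * ?n $ 2 - x $ 2 * ?n $ 1)
        * (x $ 1 * ?n $ 2 - x $ 2 * ?n $ 1)) / t = 1"
      and "x \<bullet> \<tau> = 0 \<Longrightarrow> (x \<bullet> ?n * (x \<bullet> \<tau>) + S\<^sup>2 * (x $ 1 * ?n $ 2 - x $ 2 * ?n $ 1)
        * (x $ 1 * \<tau> $ 2 - x $ 2 * \<tau> $ 1)) / t = 0"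
      and "0 < x \<bullet> ?n" for \<tau>
      using t R0 by (simp_all add: power2_eq_square)
  next
    fix v
    assume *: "(x \<bullet> v * (x \<bullet> v) + S\<^sup>2 * (x $ 1 * v $ 2 - x $ 2 * v $ 1)
        * (x $ 1 * v $ 2 - x $ 2 * v $ 1)) / t = 1 \<and>
      (\<forall>\<tau>. x \<bullet> \<tau> = 0 \<longrightarrow> (x \<bullet> v * (x \<bullet> \<tau>) + S\<^sup>2 * (x $ 1 * v $ 2 - x $ 2 * v $ 1)
        * (x $ 1 * \<tau> $ 2 - x $ 2 * \<tau> $ 1)) / t = 0) \<and> 0 < x \<bullet> v"
    \<comment> \<open>The rotation of \<open>x\<close> spans the tangent line of the circle; testing
      orthogonality against it forces \<open>v\<close> to be radial.\<close>
    define \<tau> :: "real^2" where "\<tau> = vector [- x $ 2, x $ 1]"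
    have "x \<bullet> \<tau> = 0" "x $ 1 * \<tau> $ 2 - x $ 2 * \<tau> $ 1 = t" by (simp_all add: \<tau>_def inner_2 t2)
    with * have "S\<^sup>2 * (x $ 1 * v $ 2 - x $ 2 * v $ 1) * t / t = 0" by force
    then have perp: "x $ 1 * v $ 2 - x $ 2 * v $ 1 = 0" using S t by simp
    with * t have "(x \<bullet> v)\<^sup>2 = R\<^sup>2" "0 < x \<bullet> v" by (simp_all add: power2_eq_square)
    then have xv: "x \<bullet> v = R" using R0 by (simp add: power2_eq_iff)
    have "t * v $ 1 = R * x $ 1"
      unfolding t2[symmetric] xv[symmetric] inner_2 using perp by algebra
    moreover have "t * v $ 2 = R * x $ 2"
      unfolding t2[symmetric] xv[symmetric] inner_2 using perp by algebra
    ultimately show "v = (1 / R) *\<^sub>R x"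
      using R0 t(2) by (auto simp: vec_eq_iff forall_2 power2_eq_square field_simps)
  qed
qed

lemma normal_derivative:
  assumes R: "admissible_radius K R" and x: "x \<in> sphere 0 R" and u: "smooth_on U u" "x \<in> U"
  shows "frechet_derivative u (at x) (outward_unit_normal (space_form_metric K) x) = radial u x / R"
proof -
  have "frechet_derivative u (at x) = (\<lambda>h. h $ 1 * partial 1 u x + h $ 2 * partial 2 u x)"
    using frechet_derivative_at[OF smooth_on_has_derivative_2[OF u]] by simp
  then show ?thesis
    using x by (simp add: outward_unit_normal_space_form[OF R] radial_def add_divide_distrib)
qed

section \<open>Conjugate harmonic functions\<close>

text \<open>The Cauchy-Riemann equations for u + i v with respect to the metric, together with
  homogeneity of degree \<open>k\<close>: S \<open>radial u\<close> is h du/dr. The fluxes of both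
  \<open>u\<close> and \<open>v\<close> are recorded because multiplication mixes the two
  components.\<close>

definition harmonic_pair :: "real \<Rightarrow> nat \<Rightarrow> (real^2 \<Rightarrow> real) \<Rightarrow> (real^2 \<Rightarrow> real) \<Rightarrow> bool" where
  "harmonic_pair K k u v \<longleftrightarrow> smooth_on (warp_domain K) u \<and> smooth_on (warp_domain K) v \<and>
    (\<forall>x\<in>warp_domain K.
      flux K u 1 x = partial 2 v x \<and> flux K u 2 x = - partial 1 v x \<and>
      flux K v 1 x = - partial 2 u x \<and> flux K v 2 x = partial 1 u x \<and>
      warp_ratio K (x \<bullet> x) * radial u x = real k * u x \<and>
      warp_ratio K (x \<bullet> x) * radial v x = real k * v x)"

text \<open>The complex product (u + i v)(f + i g). \<open>flux\<close> and \<open>radial\<close>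
  obey the product rule, so the Cauchy-Riemann equations persist and the degrees add up.\<close>

lemma harmonic_pair_mult:
  assumes 1: "harmonic_pair K k u v" and 2: "harmonic_pair K l f g"
  shows "harmonic_pair K (k + l) (\<lambda>x. u x * f x - v x * g x) (\<lambda>x. u x * g x + v x * f x)"
proof -
  let ?D = "warp_domain K"
  have s: "smooth_on ?D u" "smooth_on ?D v" "smooth_on ?D f" "smooth_on ?D g"
    using 1 2 by (auto simp: harmonic_pair_def)
  note sm = s smooth_on_mult smooth_on_diff smooth_on_add
  let ?p = "\<lambda>x. u x * f x - v x * g x" and ?q = "\<lambda>x. u x * g x + v x * f x"
  have pp: "partial i ?p x = u x * partial i f x + f x * partial i u x - v x * partial i g x - g x * partial i v x"
    "partial i ?q x = u x * partial i g x + g x * partial i u x + v x * partial i f x + f x * partial i v x"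
    if "x \<in> ?D" for i x
    using that by (simp_all add: partial_diff[of ?D] partial_add[of ?D] partial_mult[of ?D] sm)
  have fl: "flux K ?p i x = u x * flux K f i x + f x * flux K u i x - v x * flux K g i x - g x * flux K v i x"
    "flux K ?q i x = u x * flux K g i x + g x * flux K u i x + v x * flux K f i x + f x * flux K v i x"
    if "x \<in> ?D" for i x
    using that unfolding flux_def pp[OF that] sum_2 by (simp_all add: algebra_simps)
  have ra: "radial ?p x = u x * radial f x + f x * radial u x - v x * radial g x - g x * radial v x"
    "radial ?q x = u x * radial g x + g x * radial u x + v x * radial f x + f x * radial v x"
    if "x \<in> ?D" for x
    unfolding radial_def pp[OF that] by (simp_all add: algebra_simps)
  show ?thesis
    unfolding harmonic_pair_def
  proof (intro conjI ballI)
    show "smooth_on ?D ?p" "smooth_on ?D ?q" by (intro sm)+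
    fix x assume x: "x \<in> ?D"
    define S where "S = warp_ratio K (x \<bullet> x)"
    have h: "flux K u 1 x = partial 2 v x" "flux K u 2 x = - partial 1 v x"
      "flux K v 1 x = - partial 2 u x" "flux K v 2 x = partial 1 u x"
      "flux K f 1 x = partial 2 g x" "flux K f 2 x = - partial 1 g x"
      "flux K g 1 x = - partial 2 f x" "flux K g 2 x = partial 1 f x"
      "S * radial u x = real k * u x" "S * radial v x = real k * v x"
      "S * radial f x = real l * f x" "S * radial g x = real l * g x"
      using 1 2 x by (auto simp: harmonic_pair_def S_def)
    show "flux K ?p 1 x = partial 2 ?q x" "flux K ?p 2 x = - partial 1 ?q x"
      "flux K ?q 1 x = - partial 2 ?p x" "flux K ?q 2 x = partial 1 ?p x"
      unfolding fl[OF x] pp[OF x] h by (simp_all add: algebra_simps)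
    have "S * radial ?p x = u x * (S * radial f x) + f x * (S * radial u x) - v x * (S * radial g x) - g x * (S * radial v x)"
      "S * radial ?q x = u x * (S * radial g x) + g x * (S * radial u x) + v x * (S * radial f x) + f x * (S * radial v x)"
      unfolding ra[OF x] by (simp_all add: algebra_simps)
    then show "warp_ratio K (x \<bullet> x) * radial ?p x = real (k + l) * ?p x"
      "warp_ratio K (x \<bullet> x) * radial ?q x = real (k + l) * ?q x"
      unfolding S_def[symmetric] h by (simp_all add: algebra_simps)
  qed
qed

text \<open>The factor \<open>tan (\<surd>K r / 2) / (\<surd>K r / 2)\<close> which turns the geodesic polar coordinate into
  the isothermal (stereographic) one, as a function of \<open>r\<^sup>2\<close>.\<close>

definition stereo :: "real \<Rightarrow> real \<Rightarrow> real" where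
  "stereo K t = 2 * warp_ratio K t * inverse (1 + warp_cos K t)"

text \<open>For the isothermal radius r F(r^2), with F = \<open>stereo K\<close>, this says h d/dr
  (r F) = r F: the coordinate has degree 1. The second equation is this one after division by
  r.\<close>

lemma stereo_derivative:
  assumes "1 + warp_cos K t > 0" "warp_ratio K t > 0"
  obtains D where "(stereo K has_real_derivative D) (at t)"
    "(stereo K t + 2 * t * D) * warp_ratio K t = stereo K t"
proof -
  define S C S' where "S = warp_ratio K t" and "C = warp_cos K t" and "S' = warp_ratio_deriv K t"
  \<comment> \<open>Quotient rule for 2 S / (1 + C), with C' = - (K / 2) S.\<close>
  define D where "D = (2 * S' * (1 + C) + K * S\<^sup>2) / (1 + C)\<^sup>2"
  have C: "1 + C > 0" "1 + C \<noteq> 0" using assms by (auto simp: C_def)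
  have "((\<lambda>t. 2 * warp_ratio K t / (1 + warp_cos K t)) has_real_derivative D) (at t)"
    unfolding D_def S_def C_def S'_def
    by (rule derivative_eq_intros warp_ratio_derivative warp_cos_derivative refl C[unfolded C_def])+
       (simp add: power2_eq_square)
  then have "(stereo K has_real_derivative D) (at t)"
    by (simp add: stereo_def[abs_def] divide_inverse)
  moreover have "(stereo K t + 2 * t * D) * S = stereo K t"
  proof -
    \<comment> \<open>Substituting 2 t S' = C - S and K t S^2 = 1 - C^2 leaves a multiple of 1 + C;
      cancelling gives F + 2 t D = 2 / (1 + C), which is F / S.\<close>
    have "(1 + C)\<^sup>2 * (2 * S / (1 + C) + 2 * t * D)
        = 2 * S * (1 + C) + 2 * (2 * t * S') * (1 + C) + 2 * (K * t * S\<^sup>2)"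
      using C by (simp add: D_def divide_simps) (simp add: algebra_simps power2_eq_square)
    also have "\<dots> = 2 * (1 + C)"
      using warp_pythagoras[of K t] unfolding warp_ratio_ode[of t K, folded S'_def S_def C_def]
      by (simp add: S_def C_def algebra_simps power2_eq_square)
    finally have "(1 + C) * ((1 + C) * (2 * S / (1 + C) + 2 * t * D)) = (1 + C) * 2"
      by (simp only: power2_eq_square mult_ac)
    then have "(1 + C) * (2 * S / (1 + C) + 2 * t * D) = 2"
      by (rule mult_left_cancel[OF C(2), THEN iffD1])
    then have "2 * S / (1 + C) + 2 * t * D = 2 / (1 + C)"
      by (intro eq_divide_imp[OF C(2)]) (simp only: mult.commute)
    then show ?thesis by (simp add: stereo_def S_def C_def divide_inverse mult_ac)
  qed
  ultimately show thesis using that by (simp add: S_def)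
qed

lemma smooth_on_stereo: "smooth_on (warp_domain K) (\<lambda>x. stereo K (x \<bullet> x))"
proof -
  note o = open_warp_domain[of K]
  have d: "smooth_on (warp_domain K) (\<lambda>x. x \<bullet> x)"
    unfolding inner_2 by (intro smooth_on_add smooth_on_mult smooth_on_nth o)
  show ?thesis
    unfolding stereo_def warp_ratio_def warp_cos_def
    by (intro smooth_on_mult smooth_on_inverse smooth_on_add smooth_on_const smooth_on_series d o
        summable_warp_ratio summable_warp_cos)
       (use warp_domainD(2) in \<open>force simp: warp_cos_def\<close>)
qed

lemma harmonic_pair_stereo:
  "harmonic_pair K 1 (\<lambda>x. stereo K (x \<bullet> x) * x $ 1) (\<lambda>x. stereo K (x \<bullet> x) * x $ 2)"
    (is "harmonic_pair K 1 ?a ?b")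
  unfolding harmonic_pair_def
proof (intro conjI ballI)
  show "smooth_on (warp_domain K) ?a" "smooth_on (warp_domain K) ?b"
    by (intro smooth_on_mult smooth_on_stereo smooth_on_nth open_warp_domain)+
  fix x assume x: "x \<in> warp_domain K"
  define t where "t = x \<bullet> x"
  define S where "S = warp_ratio K t"
  define F where "F = stereo K t"
  have S: "S > 0" using warp_domainD[OF x] by (simp add: S_def t_def)
  obtain D where D: "(stereo K has_real_derivative D) (at t)" "(F + 2 * t * D) * S = F"
    using stereo_derivative[of K t] warp_domainD[OF x] by (auto simp: S_def F_def t_def)
  have dF: "((\<lambda>y. stereo K (y \<bullet> y)) has_derivative (\<lambda>h. D * (2 * (x \<bullet> h)))) (at x)"
    using has_derivative_compose_dot[OF D(1)[unfolded t_def]] .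
  have p: "partial i (\<lambda>y. stereo K (y \<bullet> y) * y $ j) x = F * axis i 1 $ j + 2 * D * x $ i * x $ j" for i j
    using partial_eqI[OF has_derivative_mult[OF dF has_derivative_nth]]
    by (simp add: F_def t_def inner_axis)
  have ax: "axis 1 (1::real) $ (1::2) = 1" "axis 1 (1::real) $ (2::2) = 0"
    "axis 2 (1::real) $ (1::2) = 0" "axis 2 (1::real) $ (2::2) = 1"
    by (simp_all add: axis_def)
  have t2: "t = x $ 1 * x $ 1 + x $ 2 * x $ 2" by (simp add: t_def inner_2)
  have ra: "radial ?a x = (F + 2 * t * D) * x $ 1" "radial ?b x = (F + 2 * t * D) * x $ 2"
    unfolding radial_def p ax t2 by (simp_all add: algebra_simps)
  have an: "angular ?a x = - (F * x $ 2)" "angular ?b x = F * x $ 1"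
    unfolding angular_def p ax by (simp_all add: algebra_simps)
  show "warp_ratio K (x \<bullet> x) * radial ?a x = real 1 * ?a x"
    "warp_ratio K (x \<bullet> x) * radial ?b x = real 1 * ?b x"
    unfolding ra using D(2) by (simp_all add: F_def S_def t_def mult_ac)
  have FS: "F / S = F + 2 * t * D" using S D(2) by (simp add: field_simps)
  have "flux K ?a 1 x = partial 2 ?b x \<and> flux K ?a 2 x = - partial 1 ?b x \<and>
    flux K ?b 1 x = - partial 2 ?a x \<and> flux K ?b 2 x = partial 1 ?a x"
  proof (cases "x = 0")
    case True
    show ?thesis using p[unfolded True] by (simp add: True flux_0 ax)
  next
    case False
    then have t0: "t \<noteq> 0" by (simp add: t_def)
    have S': "warp_ratio K (x \<bullet> x) > 0" "warp_ratio K (x \<bullet> x) = S" using S by (simp_all add: S_def t_def)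
    have SR: "S * x $ i * ((F + 2 * t * D) * x $ j) = F * x $ i * x $ j" for i j
      using D(2) by (simp add: mult_ac)
    have FR: "x $ i * (F * x $ j) / S = (F + 2 * t * D) * x $ i * x $ j" for i j
      unfolding FS[symmetric] by simp
    show ?thesis
      unfolding flux_eq[OF False S'(1)] unfolding S'(2) ra an p ax unfolding t_def[symmetric] SR
      using t0 by (simp add: FR) (simp add: divide_simps, simp add: t2 algebra_simps)
  qed
  then show "flux K ?a 1 x = partial 2 ?b x" "flux K ?a 2 x = - partial 1 ?b x"
    "flux K ?b 1 x = - partial 2 ?a x" "flux K ?b 2 x = partial 1 ?a x" by auto
qed

text \<open>The pair is the real and imaginary part of w^k. Its values on the first axis are
  recorded to show, at the boundary point (R, 0), that \<open>u\<close> is not identically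
  zero.\<close>

lemma harmonic_pair_exists:
  "\<exists>u v. harmonic_pair K k u v \<and> (\<forall>x\<in>warp_domain K. x $ 2 = 0 \<longrightarrow>
     v x = 0 \<and> u x = (stereo K (x \<bullet> x) * x $ 1) ^ k)"
proof (induction k)
  case 0
  have "harmonic_pair K 0 (\<lambda>x. 1) (\<lambda>x. 0)"
    by (simp add: harmonic_pair_def smooth_on_const open_warp_domain flux_def radial_def)
  then show ?case by (intro exI conjI) auto
next
  case (Suc k)
  then obtain u v where *: "harmonic_pair K k u v"
    "\<forall>x\<in>warp_domain K. x $ 2 = 0 \<longrightarrow> v x = 0 \<and> u x = (stereo K (x \<bullet> x) * x $ 1) ^ k"
    by blast
  show ?case
    using harmonic_pair_mult[OF harmonic_pair_stereo *(1)] *(2)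
    by (intro exI conjI) auto
qed

lemma steklov_eigenvalue_warp:
  assumes R: "admissible_radius K R"
  shows "steklov_eigenvalue (space_form_metric K) R (real k / warp K R)"
proof -
  let ?D = "warp_domain K"
  have R0: "R > 0" using R by (simp add: admissible_radius_def)
  obtain u v where uv: "harmonic_pair K k u v"
    "\<forall>x\<in>?D. x $ 2 = 0 \<longrightarrow> v x = 0 \<and> u x = (stereo K (x \<bullet> x) * x $ 1) ^ k"
    using harmonic_pair_exists by blast
  have s: "smooth_on ?D u" "smooth_on ?D v" using uv by (auto simp: harmonic_pair_def)
  have D: "cball 0 R \<subseteq> ?D" by (rule cball_subset_warp_domain[OF R])
  \<comment> \<open>The flux of \<open>u\<close> is the rotated gradient of \<open>v\<close>, hence
    divergence free by the symmetry of second derivatives.\<close>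
  have "laplace_beltrami (space_form_metric K) u x = 0" if x: "x \<in> ?D" for x
  proof -
    have "partial 1 (flux K u 1) x = partial 1 (partial 2 v) x"
      by (rule partial_cong_open[OF open_warp_domain x]) (use uv in \<open>simp add: harmonic_pair_def\<close>)
    moreover have "partial 2 (flux K u 2) x = partial 2 (\<lambda>x. - partial 1 v x) x"
      by (rule partial_cong_open[OF open_warp_domain x]) (use uv in \<open>simp add: harmonic_pair_def\<close>)
    ultimately show ?thesis
      using partial_minus[OF smooth_on_partial[OF s(2)] x] partial_commute[OF s(2) x, of 1 2]
      by (simp add: laplace_beltrami_flux)
  qed
  moreover have "frechet_derivative u (at x) (outward_unit_normal (space_form_metric K) x) =
      real k / warp K R * u x" if x: "x \<in> sphere 0 R" for x
  proof -
    have xD: "x \<in> ?D" using x D by auto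
    have xx: "x \<bullet> x = R\<^sup>2" using x by (simp add: dot_square_norm)
    have "warp_ratio K (R\<^sup>2) * radial u x = real k * u x"
      using uv(1) xD unfolding xx[symmetric] harmonic_pair_def by blast
    moreover have "warp_ratio K (R\<^sup>2) > 0" using warp_domainD(1)[OF xD] xx by simp
    ultimately show ?thesis
      unfolding normal_derivative[OF R x s(1) xD] warp_eq using R0 by (simp add: field_simps)
  qed
  moreover have "\<exists>x\<in>cball 0 R. u x \<noteq> 0"
  proof
    let ?x = "axis 1 R :: real^2"
    show x: "?x \<in> cball 0 R"
      using R0 by (simp add: norm_vec_def L2_set_def sum_2 axis_def)
    then have "?x \<in> ?D" using D by auto
    then show "u ?x \<noteq> 0"
      using uv(2) warp_domainD[of ?x K] R0 by (auto simp: stereo_def axis_def)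
  qed
  ultimately show ?thesis
    unfolding steklov_eigenvalue_def using s(1) D by blast
qed

section \<open>Fourier coefficients of Steklov eigenfunctions\<close>

definition polar :: "real \<Rightarrow> real \<Rightarrow> real^2" where
  "polar r \<theta> = (r * cos \<theta>) *\<^sub>R axis 1 1 + (r * sin \<theta>) *\<^sub>R axis 2 1"

lemma polar_nth [simp]: "polar r \<theta> $ 1 = r * cos \<theta>" "polar r \<theta> $ 2 = r * sin \<theta>"
  by (simp_all add: polar_def axis_def)

lemma polar_inner_self: "polar r \<theta> \<bullet> polar r \<theta> = r\<^sup>2"
  by (simp add: inner_2 power_mult_distrib algebra_simps flip: power2_eq_square distrib_left)

lemma norm_polar: "norm (polar r \<theta>) = \<bar>r\<bar>"
  by (simp add: norm_eq_sqrt_inner polar_inner_self)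

lemma polar_0 [simp]: "polar 0 \<theta> = 0"
  by (simp add: polar_def)

lemma continuous_on_polar [continuous_intros]:
  fixes A :: "'a::t2_space set"
  shows "continuous_on A f \<Longrightarrow> continuous_on A g \<Longrightarrow> continuous_on A (\<lambda>x. polar (f x) (g x))"
  unfolding polar_def by (intro continuous_intros)

lemma polar_exists:
  assumes "x \<noteq> 0"
  obtains \<theta> where "\<theta> \<in> {0..2 * pi}" "x = polar (norm x) \<theta>"
proof -
  have n: "(norm x)\<^sup>2 = (x $ 1)\<^sup>2 + (x $ 2)\<^sup>2" "norm x \<noteq> 0"
    using assms dot_square_norm[of x] unfolding inner_2 power2_eq_square by auto
  have "(x $ 1 / norm x)\<^sup>2 + (x $ 2 / norm x)\<^sup>2 = 1"
    using n(2) unfolding power_divide add_divide_distrib[symmetric] n(1)[symmetric] by simp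
  then obtain \<theta> where \<theta>: "0 \<le> \<theta>" "\<theta> < 2 * pi" "x $ 1 / norm x = cos \<theta>" "x $ 2 / norm x = sin \<theta>"
    using sincos_total_2pi by blast
  have "x = polar (norm x) \<theta>"
    unfolding vec_eq_iff forall_2 polar_nth \<theta>(3,4)[symmetric] using n(2) by simp
  with \<theta>(1,2) show thesis by (intro that[of \<theta>]) auto
qed

section \<open>Integrals along circles\<close>

lemma radial_derivative:
  assumes "smooth_on U f" "polar r \<theta> \<in> U" "r \<noteq> 0"
  shows "((\<lambda>r. f (polar r \<theta>)) has_real_derivative radial f (polar r \<theta>) / r) (at r within A)"
proof -
  have "((\<lambda>r. polar r \<theta>) has_derivative (\<lambda>h. (h * cos \<theta>) *\<^sub>R axis 1 1 + (h * sin \<theta>) *\<^sub>R axis 2 1))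
      (at r within A)"
    unfolding polar_def
    by (intro has_derivative_add has_derivative_scaleR_left has_derivative_mult_left has_derivative_ident)
  from has_derivative_compose[OF this smooth_on_has_derivative_2[OF assms(1,2)]]
  show ?thesis
    unfolding has_field_derivative_def radial_def
    by (rule has_derivative_eq_rhs) (use assms(3) in \<open>simp add: fun_eq_iff field_simps axis_def\<close>)
qed

lemma angular_derivative:
  assumes "smooth_on U f" "polar r \<theta> \<in> U"
  shows "((\<lambda>\<theta>. f (polar r \<theta>)) has_real_derivative angular f (polar r \<theta>)) (at \<theta> within A)"
proof -
  have "((\<lambda>\<theta>. polar r \<theta>) has_derivative
      (\<lambda>h. (r * (h * - sin \<theta>)) *\<^sub>R axis 1 1 + (r * (h * cos \<theta>)) *\<^sub>R axis 2 1)) (at \<theta> within A)"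
    unfolding polar_def
    by (intro has_derivative_add has_derivative_scaleR_left has_derivative_mult_right
        has_derivative_cos[OF has_derivative_ident] has_derivative_sin[OF has_derivative_ident])
  from has_derivative_compose[OF this smooth_on_has_derivative_2[OF assms]]
  show ?thesis
    unfolding has_field_derivative_def angular_def
    by (rule has_derivative_eq_rhs) (simp add: fun_eq_iff field_simps axis_def)
qed

text \<open>A real Fourier coefficient, up to normalisation, when \<open>c\<close> is the cosine or
  sine of j \<theta>. Leaving \<open>c\<close> general treats both at once.\<close>

definition circle_integral :: "(real^2 \<Rightarrow> real) \<Rightarrow> (real \<Rightarrow> real) \<Rightarrow> real \<Rightarrow> real" where
  "circle_integral f c r = integral {0..2 * pi} (\<lambda>\<theta>. f (polar r \<theta>) * c \<theta>)"

context
  fixes U :: "(real^2) set" and R :: real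
  assumes cball_U: "cball 0 R \<subseteq> U"
begin

lemma polar_in: "0 \<le> r \<Longrightarrow> r \<le> R \<Longrightarrow> polar r \<theta> \<in> U"
  using cball_U by (auto simp: norm_polar)

lemma continuous_on_polar_smooth:
  fixes A :: "'a::t2_space set"
  assumes "smooth_on U f" "continuous_on A p" "continuous_on A q" "\<And>x. x \<in> A \<Longrightarrow> 0 \<le> p x \<and> p x \<le> R"
  shows "continuous_on A (\<lambda>x. f (polar (p x) (q x)))"
  by (rule continuous_on_compose2[OF smooth_on_continuous_on[OF assms(1)] continuous_on_polar[OF assms(2,3)]])
     (use assms(4) polar_in in auto)

lemma has_integral_circle:
  assumes f: "smooth_on U f" and c: "continuous_on UNIV c" and r: "0 \<le> r" "r \<le> R"
  shows "((\<lambda>\<theta>. f (polar r \<theta>) * c \<theta>) has_integral circle_integral f c r) {0..2 * pi}"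
  unfolding circle_integral_def
  by (intro integrable_integral integrable_continuous_interval continuous_intros
      continuous_on_polar_smooth[OF f] continuous_on_subset[OF c]) (use r in auto)

lemma continuous_on_circle_integral:
  assumes f: "smooth_on U f" and c: "continuous_on UNIV c"
  shows "continuous_on {0..R} (circle_integral f c)"
proof -
  have "continuous_on ({0..R} \<times> cbox 0 (2 * pi)) (\<lambda>(r, \<theta>). f (polar r \<theta>) * c \<theta>)"
    unfolding split_beta
    by (intro continuous_intros continuous_on_polar_smooth[OF f] continuous_on_compose2[OF c]) auto
  from integral_continuous_on_param[OF this] show ?thesis
    by (simp add: circle_integral_def[abs_def])
qed

text \<open>Differentiation under the integral sign. Only interior radii are covered; the end points
  are later reached through continuity of the coefficient.\<close>

lemma circle_integral_derivative:
  assumes f: "smooth_on U f" and c: "continuous_on UNIV c" and r: "0 < r" "r < R"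
  shows "(circle_integral f c has_real_derivative circle_integral (radial f) c r / r) (at r)"
proof -
  have "((\<lambda>r. integral (cbox 0 (2 * pi)) (\<lambda>\<theta>. f (polar r \<theta>) * c \<theta>)) has_field_derivative
      integral (cbox 0 (2 * pi)) (\<lambda>\<theta>. radial f (polar r \<theta>) / r * c \<theta>)) (at r within {0<..<R})"
  proof (rule leibniz_rule_field_derivative)
    fix s \<theta> assume s: "s \<in> {0<..<R}"
    then show "((\<lambda>r. f (polar r \<theta>) * c \<theta>) has_real_derivative radial f (polar s \<theta>) / s * c \<theta>)
        (at s within {0<..<R})"
      by (intro DERIV_cmult_right radial_derivative[OF f]) (auto intro: polar_in)
    show "(\<lambda>\<theta>. f (polar s \<theta>) * c \<theta>) integrable_on cbox 0 (2 * pi)"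
      using has_integral_circle[OF f c, of s] s by (auto simp: integrable_on_def)
  next
    show "continuous_on ({0<..<R} \<times> cbox 0 (2 * pi)) (\<lambda>(s, \<theta>). radial f (polar s \<theta>) / s * c \<theta>)"
      unfolding split_beta
      by (intro continuous_intros continuous_on_polar_smooth[OF smooth_on_radial[OF f]]
          continuous_on_compose2[OF c]) auto
  qed (use r in auto)
  then show ?thesis
    using r by (simp add: circle_integral_def[abs_def] at_within_open[of r "{0<..<R}"])
qed

text \<open>The boundary terms cancel because both the circle and \<open>c\<close> close up after a
  full turn.\<close>

lemma circle_integral_by_parts:
  assumes f: "smooth_on U f" and c: "\<And>\<theta>. (c has_real_derivative c' \<theta>) (at \<theta>)"
    and c': "continuous_on UNIV c'" and per: "c (2 * pi) = c 0" and r: "0 \<le> r" "r \<le> R"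
  shows "circle_integral (angular f) c r = - circle_integral f c' r"
proof -
  have cc: "continuous_on UNIV c"
    using c by (meson DERIV_isCont continuous_at_imp_continuous_on)
  have "((\<lambda>\<theta>. f (polar r \<theta>) * c \<theta>) has_real_derivative
      f (polar r \<theta>) * c' \<theta> + angular f (polar r \<theta>) * c \<theta>) (at \<theta> within A)" for \<theta> A
    by (rule DERIV_mult'[OF angular_derivative[OF f polar_in[OF r]] has_field_derivative_at_within[OF c]])
  then have "((\<lambda>\<theta>. f (polar r \<theta>) * c' \<theta> + angular f (polar r \<theta>) * c \<theta>) has_integral
      f (polar r (2 * pi)) * c (2 * pi) - f (polar r 0) * c 0) {0..2 * pi}"
    unfolding has_real_derivative_iff_has_vector_derivative
    by (intro fundamental_theorem_of_calculus) simp_all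
  moreover have "polar r (2 * pi) = polar r 0" by (simp add: polar_def)
  ultimately have 0: "((\<lambda>\<theta>. f (polar r \<theta>) * c' \<theta> + angular f (polar r \<theta>) * c \<theta>) has_integral 0) {0..2 * pi}"
    by (simp add: per)
  have "((\<lambda>\<theta>. f (polar r \<theta>) * c' \<theta> + angular f (polar r \<theta>) * c \<theta>) has_integral
      circle_integral f c' r + circle_integral (angular f) c r) {0..2 * pi}"
    by (intro has_integral_add has_integral_circle f smooth_on_angular c' cc r)
  from has_integral_unique[OF 0 this] show ?thesis by simp
qed

text \<open>The Fourier coefficients \<open>a\<close> of \<open>u\<close> and \<open>b\<close> of \<open>h \<partial>u/\<partial>r\<close> satisfy \<open>h a' = b\<close> and
  \<open>h b' = k\<^sup>2 a\<close>. As \<open>b - k a\<close> vanishes at the pole and \<open>h (b - k a)' = - k (b - k a)\<close>, it vanishes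
  identically, so \<open>h a' = k a\<close>; the boundary condition then forces \<open>a (R) = 0\<close> and \<open>a\<^sup>2\<close> increases.\<close>

lemma steklov_fourier_coefficient:
  fixes k :: real
  assumes adm: "admissible_radius K R"
    and u: "smooth_on U u"
    and harm: "\<And>x. x \<in> cball 0 R \<Longrightarrow> laplace_beltrami (space_form_metric K) u x = 0"
    and bdry: "\<And>x. x \<in> sphere 0 R \<Longrightarrow> radial u x / R = \<sigma> * u x"
    and k: "k \<ge> 0" "warp K R * \<sigma> \<noteq> k"
    and c: "\<And>\<theta>. (c has_real_derivative c' \<theta>) (at \<theta>)" "c (2 * pi) = c 0"
    and c': "\<And>\<theta>. (c' has_real_derivative - (k\<^sup>2 * c \<theta>)) (at \<theta>)" "c' (2 * pi) = c' 0"
    and r: "0 < r" "r \<le> R"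
  shows "circle_integral u c r = 0"
proof -
  have R: "R > 0" using adm by (simp add: admissible_radius_def)
  have cc: "continuous_on UNIV c" "continuous_on UNIV c'"
    using c c' by (meson DERIV_isCont continuous_at_imp_continuous_on)+
  note sm = u smooth_on_radial smooth_on_angular
  have D: "polar r \<theta> \<in> warp_domain K" if "0 \<le> r" "r \<le> R" for r \<theta>
    using cball_subset_warp_domain[OF adm] that by (auto simp: norm_polar)
  have S: "warp_ratio K (r\<^sup>2) > 0" if "0 \<le> r" "r \<le> R" for r
    using warp_domainD(1)[OF D[OF that]] by (simp add: polar_inner_self)
  define S where "S r = warp_ratio K (r\<^sup>2)" for r
  define a where "a = circle_integral u c"
  define w where "w = circle_integral (radial u) c"
  define b where "b r = S r * w r" for r
  have Spos: "S r > 0" if "0 \<le> r" "r \<le> R" for r using S[OF that] by (simp add: S_def)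
  have da: "(a has_real_derivative b r / (r * S r)) (at r)" if "0 < r" "r < R" for r
    using circle_integral_derivative[OF u cc(1) that] Spos[of r] that
    by (simp add: a_def b_def w_def)
  have db: "(b has_real_derivative k\<^sup>2 * a r / (r * S r)) (at r)" if r: "0 < r" "r < R" for r
  proof -
    define S' where "S' = warp_ratio_deriv K (r\<^sup>2)"
    define w2 where "w2 = circle_integral (radial (radial u)) c r"
    define z where "z = circle_integral (angular (angular u)) c r"
    have r': "0 \<le> r" "r \<le> R" using r by auto
    have "(\<lambda>\<theta>. u (polar r \<theta>) * - (k\<^sup>2 * c \<theta>)) = (\<lambda>\<theta>. - (k\<^sup>2) * (u (polar r \<theta>) * c \<theta>))"
      by (simp add: fun_eq_iff)
    then have cc2: "circle_integral u (\<lambda>\<theta>. - (k\<^sup>2 * c \<theta>)) r = - (k\<^sup>2 * a r)"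
      by (simp only: circle_integral_def a_def integral_mult_right)
    \<comment> \<open>Two integrations by parts move both angular derivatives onto \<open>c\<close>,
      where c'' = - k^2 c.\<close>
    have "z = - circle_integral (angular u) c' r"
      unfolding z_def by (intro circle_integral_by_parts sm c cc r')
    also have "circle_integral (angular u) c' r = - circle_integral u (\<lambda>\<theta>. - (k\<^sup>2 * c \<theta>)) r"
      by (intro circle_integral_by_parts sm c' r' continuous_intros cc)
    also note cc2
    finally have z: "z = - (k\<^sup>2 * a r)" by simp
    have "((\<lambda>\<theta>. (S r)\<^sup>2 * (radial (radial u) (polar r \<theta>) * c \<theta>)
        + 2 * r\<^sup>2 * S' * S r * (radial u (polar r \<theta>) * c \<theta>) + angular (angular u) (polar r \<theta>) * c \<theta>)
        has_integral ((S r)\<^sup>2 * w2 + 2 * r\<^sup>2 * S' * S r * w r + z)) {0..2 * pi}"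
      unfolding w2_def w_def z_def
      by (intro has_integral_add has_integral_mult_right has_integral_circle sm cc r')
    moreover have "(S r)\<^sup>2 * (radial (radial u) (polar r \<theta>) * c \<theta>)
        + 2 * r\<^sup>2 * S' * S r * (radial u (polar r \<theta>) * c \<theta>) + angular (angular u) (polar r \<theta>) * c \<theta> = 0" for \<theta>
    proof -
      have "polar r \<theta> \<noteq> 0" using r norm_polar[of r \<theta>] by auto
      from laplace_beltrami_polar[OF u polar_in[OF r'] D[OF r'] this]
      have "(S r)\<^sup>2 * radial (radial u) (polar r \<theta>) + 2 * r\<^sup>2 * S' * S r * radial u (polar r \<theta>)
          + angular (angular u) (polar r \<theta>) = 0"
        using harm[of "polar r \<theta>"] r by (simp add: norm_polar polar_inner_self S_def S'_def)
      then have "((S r)\<^sup>2 * radial (radial u) (polar r \<theta>) + 2 * r\<^sup>2 * S' * S r * radial u (polar r \<theta>)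
          + angular (angular u) (polar r \<theta>)) * c \<theta> = 0" by simp
      then show ?thesis by (simp only: distrib_right mult.assoc)
    qed
    ultimately have "((\<lambda>\<theta>::real. 0::real) has_integral ((S r)\<^sup>2 * w2 + 2 * r\<^sup>2 * S' * S r * w r + z)) {0..2 * pi}"
      by simp
    then have pde: "(S r)\<^sup>2 * w2 + 2 * r\<^sup>2 * S' * S r * w r + z = 0"
      using has_integral_0 has_integral_unique by blast
    have "(S has_real_derivative S' * (2 * r)) (at r)"
      unfolding S_def[abs_def] S'_def
      by (rule DERIV_chain2[OF warp_ratio_derivative]) (auto intro!: derivative_eq_intros)
    moreover have "(w has_real_derivative w2 / r) (at r)"
      unfolding w_def w2_def by (intro circle_integral_derivative sm cc r)
    ultimately have "(b has_real_derivative S r * (w2 / r) + S' * (2 * r) * w r) (at r)"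
      unfolding b_def[abs_def] by (rule DERIV_mult')
    also have "S r * (w2 / r) + S' * (2 * r) * w r = k\<^sup>2 * a r / (r * S r)"
      using pde Spos[OF r'] r unfolding z by (simp add: field_simps power2_eq_square)
    finally show ?thesis .
  qed
  have ca: "continuous_on {0..R} a" unfolding a_def by (intro continuous_on_circle_integral u cc)
  have cb: "continuous_on {0..R} b"
    unfolding b_def[abs_def] w_def S_def
    by (intro continuous_intros continuous_on_circle_integral sm cc
        continuous_on_compose2[OF continuous_on_warp_ratio]) auto
  have b0: "b 0 = 0" by (simp add: b_def w_def circle_integral_def radial_def)
  \<comment> \<open>At the pole \<open>u\<close> does not depend on \<theta>, so \<open>a 0\<close>
    is u(0) times the integral of \<open>c\<close>; for \<open>k\<close> other than 0 that integral
    vanishes, since k^2 c is the derivative of the periodic function - c'.\<close>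
  have ka0: "k * a 0 = 0"
  proof -
    have "((\<lambda>\<theta>. - (k\<^sup>2 * c \<theta>)) has_integral c' (2 * pi) - c' 0) {0..2 * pi}"
      using has_field_derivative_at_within[OF c'(1)]
      unfolding has_real_derivative_iff_has_vector_derivative
      by (intro fundamental_theorem_of_calculus) simp_all
    then have "integral {0..2 * pi} (\<lambda>\<theta>. k\<^sup>2 * c \<theta>) = 0"
      using c'(2) by (metis diff_self integral_neg integral_unique neg_equal_0_iff_equal)
    then have "k = 0 \<or> integral {0..2 * pi} c = 0" by simp
    then show ?thesis by (auto simp: a_def circle_integral_def)
  qed
  define W where "W r = b r - k * a r" for r
  have W: "W r = 0" if r: "0 \<le> r" "r \<le> R" for r
  proof -
    \<comment> \<open>The equation W' = - k W / (r S) is singular at 0, so uniqueness for regular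
      initial value problems does not apply. Instead W^2 is nonincreasing, continuous at 0 and zero
      there.\<close>
    have "(W r)\<^sup>2 \<le> (W 0)\<^sup>2"
    proof (rule DERIV_nonpos_imp_decreasing_open[OF r(1)])
      show "continuous_on {0..r} (\<lambda>r. (W r)\<^sup>2)"
        unfolding W_def using r
        by (intro continuous_intros continuous_on_subset[OF ca] continuous_on_subset[OF cb]) auto
      fix s assume s: "0 < s" "s < r"
      then have s': "0 < s" "s < R" using r by auto
      have "(W has_real_derivative k\<^sup>2 * a s / (s * S s) - k * (b s / (s * S s))) (at s)"
        unfolding W_def[abs_def] by (intro DERIV_diff DERIV_cmult da db s')
      also have "k\<^sup>2 * a s / (s * S s) - k * (b s / (s * S s)) = - (k / (s * S s)) * W s"
        by (simp add: W_def power2_eq_square right_diff_distrib diff_divide_distrib)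
      finally have "((\<lambda>r. (W r)\<^sup>2) has_real_derivative 2 * W s * (- (k / (s * S s)) * W s)) (at s)"
        by (auto intro!: derivative_eq_intros)
      moreover have "2 * W s * (- (k / (s * S s)) * W s) = - (2 * (k / (s * S s)) * (W s)\<^sup>2)"
        by (simp add: power2_eq_square)
      moreover have "2 * (k / (s * S s)) * (W s)\<^sup>2 \<ge> 0"
        using k Spos[of s] s' by simp
      ultimately show "\<exists>y. ((\<lambda>r. (W r)\<^sup>2) has_real_derivative y) (at s) \<and> y \<le> 0"
        by (metis neg_le_0_iff_le)
    qed
    moreover have "W 0 = 0" using b0 ka0 by (simp add: W_def)
    ultimately show ?thesis by simp
  qed
  \<comment> \<open>Combined with b(R) = k a(R), this gives (h(R) \<sigma> - k) a(R) = 0.\<close>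
  have bR: "b R = warp K R * \<sigma> * a R"
  proof -
    have "radial u (polar R \<theta>) * c \<theta> = R * \<sigma> * (u (polar R \<theta>) * c \<theta>)" for \<theta>
      using bdry[of "polar R \<theta>"] R by (simp add: norm_polar field_simps)
    then have "w R = R * \<sigma> * a R"
      by (simp only: w_def a_def circle_integral_def integral_mult_right)
    then show ?thesis by (simp add: b_def S_def warp_eq)
  qed
  then have "a R = 0" using W[of R] k(2) R by (simp add: W_def)
  have "(a r)\<^sup>2 \<le> (a R)\<^sup>2"
  proof (rule DERIV_nonneg_imp_increasing_open[OF r(2)])
    show "continuous_on {r..R} (\<lambda>r. (a r)\<^sup>2)"
      using r by (intro continuous_intros continuous_on_subset[OF ca]) auto
    fix s assume s: "r < s" "s < R"
    then have s': "0 < s" "s < R" using r by auto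
    have "((\<lambda>r. (a r)\<^sup>2) has_real_derivative 2 * a s * (b s / (s * S s))) (at s)"
      using da[OF s'] by (auto intro!: derivative_eq_intros)
    moreover have "2 * a s * (b s / (s * S s)) = 2 * (k / (s * S s)) * (a s)\<^sup>2"
      using W[of s] s' by (simp add: W_def power2_eq_square)
    moreover have "2 * (k / (s * S s)) * (a s)\<^sup>2 \<ge> 0"
      using k Spos[of s] s' by simp
    ultimately show "\<exists>y. ((\<lambda>r. (a r)\<^sup>2) has_real_derivative y) (at s) \<and> 0 \<le> y"
      by metis
  qed
  then show ?thesis using \<open>a R = 0\<close> by (simp add: a_def)
qed

end

text \<open>Polynomials in x and y restrict to trigonometric polynomials on the circle, so they are
  orthogonal to \<open>f\<close>. For a polynomial P within e of \<open>f\<close>, the integral of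
  f^2 equals that of f (f - P) and is at most e times the integral of the absolute value of f.
  Integer frequencies keep the shifts by 1 free of cases.\<close>

lemma trigonometric_completeness:
  fixes f :: "real^2 \<Rightarrow> real"
  assumes r: "r \<ge> 0" and f: "continuous_on (sphere 0 r) f"
    and cos0: "\<And>j::int. circle_integral f (\<lambda>\<theta>. cos (of_int j * \<theta>)) r = 0"
    and sin0: "\<And>j::int. circle_integral f (\<lambda>\<theta>. sin (of_int j * \<theta>)) r = 0"
    and \<theta>: "\<theta> \<in> {0..2 * pi}"
  shows "f (polar r \<theta>) = 0"
proof -
  let ?I = "\<lambda>p. circle_integral f p r"
  have F: "continuous_on A (\<lambda>\<theta>. f (polar r \<theta>))" for A
    by (rule continuous_on_compose2[OF f]) (use r in \<open>auto intro!: continuous_intros simp: norm_polar\<close>)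
  have lin: "?I (\<lambda>\<theta>. a * p \<theta> + b * q \<theta>) = a * ?I p + b * ?I q"
    if "continuous_on UNIV p" "continuous_on UNIV q" for a b p q
  proof -
    have "((\<lambda>\<theta>. f (polar r \<theta>) * s \<theta>) has_integral ?I s) {0..2 * pi}" if "continuous_on UNIV s" for s
      unfolding circle_integral_def
      by (intro integrable_integral integrable_continuous_interval continuous_intros F
          continuous_on_subset[OF that]) auto
    then have "((\<lambda>\<theta>. a * (f (polar r \<theta>) * p \<theta>) + b * (f (polar r \<theta>) * q \<theta>)) has_integral
        a * ?I p + b * ?I q) {0..2 * pi}"
      using that by (intro has_integral_add has_integral_mult_right) auto
    then have "integral {0..2 * pi} (\<lambda>\<theta>. a * (f (polar r \<theta>) * p \<theta>) + b * (f (polar r \<theta>) * q \<theta>))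
        = a * ?I p + b * ?I q"
      by (rule integral_unique)
    moreover have "(\<lambda>\<theta>. a * (f (polar r \<theta>) * p \<theta>) + b * (f (polar r \<theta>) * q \<theta>))
        = (\<lambda>\<theta>. f (polar r \<theta>) * (a * p \<theta> + b * q \<theta>))"
      by (simp add: algebra_simps)
    ultimately show ?thesis by (simp add: circle_integral_def)
  qed
  \<comment> \<open>Orthogonality of f p to all frequencies, not just of \<open>f\<close> to
    \<open>p\<close>: the stronger property survives multiplication of \<open>p\<close> by cos
    \<theta> and sin \<theta>, by the product-to-sum formulas.\<close>
  define T where "T p \<longleftrightarrow> continuous_on UNIV p \<and> (\<forall>j::int. ?I (\<lambda>\<theta>. p \<theta> * cos (of_int j * \<theta>)) = 0 \<and>
    ?I (\<lambda>\<theta>. p \<theta> * sin (of_int j * \<theta>)) = 0)" for p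
  have T1: "T (\<lambda>\<theta>. 1)" using cos0 sin0 by (simp add: T_def)
  have cont: "continuous_on UNIV (\<lambda>\<theta>. p \<theta> * cos (of_int j * \<theta>))"
    "continuous_on UNIV (\<lambda>\<theta>. p \<theta> * sin (of_int j * \<theta>))" if "T p" for p and j :: int
    using that by (auto simp: T_def intro!: continuous_intros)
  have I0: "?I (\<lambda>\<theta>. p \<theta> * cos (of_int j * \<theta>)) = 0" "?I (\<lambda>\<theta>. p \<theta> * sin (of_int j * \<theta>)) = 0"
    if "T p" for p and j :: int
    using that by (auto simp: T_def)
  have Tlin: "T (\<lambda>\<theta>. a * p \<theta> + b * q \<theta>)" if "T p" "T q" for a b p q
  proof -
    have "?I (\<lambda>\<theta>. (a * p \<theta> + b * q \<theta>) * cos (of_int j * \<theta>)) = 0" for j :: int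
      using lin[OF cont(1)[OF that(1)] cont(1)[OF that(2)], of a j b j] I0(1)[OF that(1)] I0(1)[OF that(2)]
      by (simp add: distrib_right mult.assoc)
    moreover have "?I (\<lambda>\<theta>. (a * p \<theta> + b * q \<theta>) * sin (of_int j * \<theta>)) = 0" for j :: int
      using lin[OF cont(2)[OF that(1)] cont(2)[OF that(2)], of a j b j] I0(2)[OF that(1)] I0(2)[OF that(2)]
      by (simp add: distrib_right mult.assoc)
    ultimately show ?thesis using that by (auto simp: T_def intro!: continuous_intros)
  qed
  have Tcos: "T (\<lambda>\<theta>. cos \<theta> * p \<theta>)" if "T p" for p
  proof -
    have "cos \<theta> * p \<theta> * cos (of_int j * \<theta>) =
        1/2 * (p \<theta> * cos (of_int (j + 1) * \<theta>)) + 1/2 * (p \<theta> * cos (of_int (j - 1) * \<theta>))"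
      "cos \<theta> * p \<theta> * sin (of_int j * \<theta>) =
        1/2 * (p \<theta> * sin (of_int (j + 1) * \<theta>)) + 1/2 * (p \<theta> * sin (of_int (j - 1) * \<theta>))"
      for j :: int and \<theta>
      by (simp_all add: distrib_right left_diff_distrib cos_add cos_diff sin_add sin_diff algebra_simps)
    note eq = this
    have "continuous_on UNIV (\<lambda>\<theta>. cos \<theta> * p \<theta>)"
      using that by (auto simp: T_def intro!: continuous_intros)
    then show ?thesis
      unfolding T_def eq
      by (simp only: lin[OF cont(1)[OF that] cont(1)[OF that]] lin[OF cont(2)[OF that] cont(2)[OF that]]
          I0[OF that]) simp
  qed
  have Tsin: "T (\<lambda>\<theta>. sin \<theta> * p \<theta>)" if "T p" for p
  proof -
    have "sin \<theta> * p \<theta> * cos (of_int j * \<theta>) =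
        1/2 * (p \<theta> * sin (of_int (j + 1) * \<theta>)) + (- 1/2) * (p \<theta> * sin (of_int (j - 1) * \<theta>))"
      "sin \<theta> * p \<theta> * sin (of_int j * \<theta>) =
        (- 1/2) * (p \<theta> * cos (of_int (j + 1) * \<theta>)) + 1/2 * (p \<theta> * cos (of_int (j - 1) * \<theta>))"
      for j :: int and \<theta>
      by (simp_all add: distrib_right left_diff_distrib cos_add cos_diff sin_add sin_diff algebra_simps)
    note eq = this
    have "continuous_on UNIV (\<lambda>\<theta>. sin \<theta> * p \<theta>)"
      using that by (auto simp: T_def intro!: continuous_intros)
    then show ?thesis
      unfolding T_def eq
      by (simp only: lin[OF cont(1)[OF that] cont(1)[OF that]] lin[OF cont(2)[OF that] cont(2)[OF that]]
          I0[OF that]) simp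
  qed
  \<comment> \<open>The factor \<open>p\<close> is kept arbitrary so that a product P Q is handled
    by multiplying first with Q, then with P.\<close>
  have Tpoly: "T (\<lambda>\<theta>. P (polar r \<theta>) * p \<theta>)" if "real_polynomial_function P" "T p" for P p
    using that
  proof (induction arbitrary: p)
    case (linear P)
    interpret bounded_linear P by fact
    have "T (\<lambda>\<theta>. (r * P (axis 1 1)) * (cos \<theta> * p \<theta>) + (r * P (axis 2 1)) * (sin \<theta> * p \<theta>))"
      by (intro Tlin Tcos Tsin \<open>T p\<close>)
    moreover have "(r * P (axis 1 1)) * (cos \<theta> * p \<theta>) + (r * P (axis 2 1)) * (sin \<theta> * p \<theta>)
        = P (polar r \<theta>) * p \<theta>" for \<theta>
      by (simp add: polar_def add scaleR algebra_simps)
    ultimately show ?case by simp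
  next
    case (const c)
    show ?case using Tlin[OF const const, of c 0] by simp
  next
    case (add P Q)
    show ?case using Tlin[OF add.IH(1)[OF add.prems] add.IH(2)[OF add.prems], of 1 1]
      by (simp add: distrib_right)
  next
    case (mult P Q)
    show ?case using mult.IH(1)[OF mult.IH(2)[OF mult.prems]] by (simp add: mult.assoc)
  qed
  define N where "N = integral {0..2 * pi} (\<lambda>\<theta>. \<bar>f (polar r \<theta>)\<bar>)"
  have "integral {0..2 * pi} (\<lambda>\<theta>. (f (polar r \<theta>))\<^sup>2) \<le> e * N" if e: "e > 0" for e
  proof -
    obtain P where P: "real_polynomial_function P"
      "\<And>x. x \<in> sphere 0 r \<Longrightarrow> \<bar>f x - P x\<bar> < e"
      using Stone_Weierstrass_real_polynomial_function[OF compact_sphere f e] by blast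
    have cP: "continuous_on UNIV (\<lambda>\<theta>. P (polar r \<theta>))" and P0: "?I (\<lambda>\<theta>. P (polar r \<theta>)) = 0"
      using Tpoly[OF P(1) T1] I0(1)[OF Tpoly[OF P(1) T1], of 0] by (simp_all add: T_def)
    have cP': "continuous_on A (\<lambda>\<theta>. P (polar r \<theta>))" for A
      using cP continuous_on_subset by blast
    have "integral {0..2 * pi} (\<lambda>\<theta>. (f (polar r \<theta>))\<^sup>2) =
        integral {0..2 * pi} (\<lambda>\<theta>. (f (polar r \<theta>))\<^sup>2) - integral {0..2 * pi} (\<lambda>\<theta>. f (polar r \<theta>) * P (polar r \<theta>))"
      using P0 by (simp add: circle_integral_def)
    also have "\<dots> = integral {0..2 * pi} (\<lambda>\<theta>. (f (polar r \<theta>))\<^sup>2 - f (polar r \<theta>) * P (polar r \<theta>))"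
      by (intro integral_diff[symmetric] integrable_continuous_interval continuous_intros F cP')
    also have "\<dots> \<le> integral {0..2 * pi} (\<lambda>\<theta>. e * \<bar>f (polar r \<theta>)\<bar>)"
    proof (intro integral_le integrable_continuous_interval continuous_intros F cP')
      fix \<theta>
      have "(f (polar r \<theta>))\<^sup>2 - f (polar r \<theta>) * P (polar r \<theta>) = f (polar r \<theta>) * (f (polar r \<theta>) - P (polar r \<theta>))"
        by (simp add: algebra_simps power2_eq_square)
      also have "\<dots> \<le> \<bar>f (polar r \<theta>)\<bar> * \<bar>f (polar r \<theta>) - P (polar r \<theta>)\<bar>"
        by (metis abs_ge_self abs_mult)
      also have "\<dots> \<le> \<bar>f (polar r \<theta>)\<bar> * e"
        using P(2)[of "polar r \<theta>"] r by (intro mult_left_mono) (auto simp: norm_polar)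
      finally show "(f (polar r \<theta>))\<^sup>2 - f (polar r \<theta>) * P (polar r \<theta>) \<le> e * \<bar>f (polar r \<theta>)\<bar>"
        by (simp add: mult.commute)
    qed
    also have "\<dots> = e * N" by (simp add: N_def)
    finally show ?thesis .
  qed
  note le = this
  have "N \<ge> 0" unfolding N_def by (intro integral_nonneg integrable_continuous_interval continuous_intros F) auto
  have "integral {0..2 * pi} (\<lambda>\<theta>. (f (polar r \<theta>))\<^sup>2) \<le> 0"
  proof (rule field_le_epsilon)
    fix e :: real assume e: "e > 0"
    \<comment> \<open>\<open>N + 1\<close> instead of \<open>N\<close>, which may be 0.\<close>
    have "integral {0..2 * pi} (\<lambda>\<theta>. (f (polar r \<theta>))\<^sup>2) \<le> e / (N + 1) * N"
      using e \<open>N \<ge> 0\<close> by (intro le) simp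
    also have "\<dots> \<le> e" using e \<open>N \<ge> 0\<close> by (simp add: field_simps)
    finally show "integral {0..2 * pi} (\<lambda>\<theta>. (f (polar r \<theta>))\<^sup>2) \<le> 0 + e" by simp
  qed
  moreover have "integral {0..2 * pi} (\<lambda>\<theta>. (f (polar r \<theta>))\<^sup>2) \<ge> 0"
    by (intro integral_nonneg integrable_continuous_interval continuous_intros F) auto
  ultimately have "integral {0..2 * pi} (\<lambda>\<theta>. (f (polar r \<theta>))\<^sup>2) = 0" by simp
  then have "\<forall>\<theta>\<in>{0..2 * pi}. (f (polar r \<theta>))\<^sup>2 = 0"
    by (subst (asm) integral_eq_0_iff) (auto intro!: continuous_intros F)
  then show ?thesis using \<theta> by simp
qed

lemma steklov_eigenvalue_imp:
  assumes R: "admissible_radius K R" and ev: "steklov_eigenvalue (space_form_metric K) R \<sigma>"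
  shows "\<exists>k::nat. \<sigma> = real k / warp K R"
proof (rule ccontr)
  have R0: "R > 0" using R by (simp add: admissible_radius_def)
  have h: "warp K R > 0" using warp_pos[OF R R0] by simp
  assume "\<not> ?thesis"
  then have ne: "warp K R * \<sigma> \<noteq> real k" for k :: nat
    using h by (metis less_irrefl nonzero_mult_div_cancel_left)
  obtain u U where u: "cball 0 R \<subseteq> U" "smooth_on U u" "\<exists>x\<in>cball 0 R. u x \<noteq> 0"
    "\<And>x. x \<in> cball 0 R \<Longrightarrow> laplace_beltrami (space_form_metric K) u x = 0"
    "\<And>x. x \<in> sphere 0 R \<Longrightarrow> frechet_derivative u (at x) (outward_unit_normal (space_form_metric K) x) = \<sigma> * u x"
    using ev unfolding steklov_eigenvalue_def by blast
  have bdry: "radial u x / R = \<sigma> * u x" if "x \<in> sphere 0 R" for x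
    using u(5)[OF that] normal_derivative[OF R that u(2)] that u(1) by auto
  have coef: "circle_integral u c r = 0"
    if "\<And>\<theta>. (c has_real_derivative c' \<theta>) (at \<theta>)" "c (2 * pi) = c 0"
      "\<And>\<theta>. (c' has_real_derivative - ((real_of_int j)\<^sup>2 * c \<theta>)) (at \<theta>)" "c' (2 * pi) = c' 0"
      "0 < r" "r \<le> R" for c c' r and j :: int
    \<comment> \<open>Only the square of the frequency enters the equation for \<open>c\<close>, so
      j may be replaced by its absolute value, a natural number to which \<open>ne\<close>
      applies.\<close>
    by (rule steklov_fourier_coefficient[OF u(1) R u(2,4) bdry, where k = "real_of_int \<bar>j\<bar>" and c' = c'])
       (use that ne[of "nat \<bar>j\<bar>"] in auto)
  have per: "cos (real_of_int j * (2 * pi)) = 1" "sin (real_of_int j * (2 * pi)) = 0" for j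
    using cos_int_2pin[of j] sin_int_2pin[of j] by (simp_all add: mult_ac)
  have zero: "u (polar r \<theta>) = 0" if r: "0 < r" "r \<le> R" and \<theta>: "\<theta> \<in> {0..2 * pi}" for r \<theta>
  proof (rule trigonometric_completeness[OF _ _ _ _ \<theta>])
    show "continuous_on (sphere 0 r) u"
      using u(1) r by (intro continuous_on_subset[OF smooth_on_continuous_on[OF u(2)]]) auto
    fix j :: int
    show "circle_integral u (\<lambda>\<theta>. cos (of_int j * \<theta>)) r = 0"
      by (rule coef[where c' = "\<lambda>\<theta>. - of_int j * sin (of_int j * \<theta>)" and j = j])
         (use r in \<open>auto intro!: derivative_eq_intros simp: per power2_eq_square\<close>)
    show "circle_integral u (\<lambda>\<theta>. sin (of_int j * \<theta>)) r = 0"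
      by (rule coef[where c' = "\<lambda>\<theta>. of_int j * cos (of_int j * \<theta>)" and j = j])
         (use r in \<open>auto intro!: derivative_eq_intros simp: per power2_eq_square\<close>)
  qed (use r in simp)
  \<comment> \<open>The centre lies on no circle of positive radius; it is reached by continuity
    along a ray.\<close>
  have "u (polar 0 0) = 0"
  proof (rule continuous_constant_on_closure[where S = "{0<..<R}" and f = "\<lambda>r. u (polar r 0)" and x = 0])
    show "continuous_on (closure {0<..<R}) (\<lambda>r. u (polar r 0))"
      using R0 by (intro continuous_on_polar_smooth[OF u(1,2)] continuous_intros) auto
  qed (use R0 zero[of _ 0] in auto)
  then have "u x = 0" if "x \<in> cball 0 R" for x
    using that zero polar_exists[of x] by (cases "x = 0") (auto, metis zero_less_norm_iff)
  with u(3) show False by blast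
qed

text \<open>Writing s n = t (k n) makes \<open>k\<close> strictly increasing, so n \<le> k n and t n
  \<le> s n; the other inequality is symmetric. This gives the uniqueness required by the
  description in \<open>steklov_sigma\<close>.\<close>

lemma strict_mono_range_unique:
  fixes s t :: "nat \<Rightarrow> real"
  assumes s: "strict_mono s" and t: "strict_mono t" and "range s = range t"
  shows "s = t"
proof -
  have le: "t n \<le> s n" if "strict_mono s" "strict_mono t" "range s \<subseteq> range t" for s t :: "nat \<Rightarrow> real" and n
  proof -
    from that(3) have "\<forall>n. \<exists>k. s n = t k" by blast
    then obtain k where k: "\<And>n. s n = t (k n)" by metis
    have "strict_mono k"
      using that(1,2) by (simp add: strict_mono_def k) (metis k linorder_neqE_nat order_less_asym strict_mono_def that(1))
    then have "n \<le> k n" by (rule strict_mono_imp_increasing)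
    then show ?thesis using that(2) k by (simp add: strict_mono_less_eq)
  qed
  show ?thesis
    using le[OF s t] le[OF t s] assms(3) by (auto intro!: ext antisym)
qed

lemma steklov_sigma_space_form:
  assumes R: "admissible_radius K R"
  shows "steklov_sigma (space_form_metric K) R = (\<lambda>k. real k / warp K R)"
proof -
  have h: "warp K R > 0" using warp_pos[OF R] R by (simp add: admissible_radius_def)
  have ev: "{\<sigma>. steklov_eigenvalue (space_form_metric K) R \<sigma>} = range (\<lambda>k. real k / warp K R)"
    using steklov_eigenvalue_imp[OF R] steklov_eigenvalue_warp[OF R] by auto
  have mono: "strict_mono (\<lambda>k. real k / warp K R)"
    using h by (simp add: strict_mono_def divide_strict_right_mono)
  show ?thesis
    unfolding steklov_sigma_def ev
    by (rule the_equality) (use mono strict_mono_range_unique in auto)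
qed

section \<open>Monotonicity in the curvature\<close>

lemma warp_derivative: "(warp K has_real_derivative warp_cos K (r\<^sup>2)) (at r)"
proof -
  have "((\<lambda>r. r * warp_ratio K (r\<^sup>2)) has_real_derivative
      r * (warp_ratio_deriv K (r\<^sup>2) * (2 * r)) + 1 * warp_ratio K (r\<^sup>2)) (at r)"
    by (intro DERIV_mult' DERIV_ident DERIV_chain2[OF warp_ratio_derivative])
       (auto intro!: derivative_eq_intros)
  moreover have "r * (warp_ratio_deriv K (r\<^sup>2) * (2 * r)) + 1 * warp_ratio K (r\<^sup>2) = warp_cos K (r\<^sup>2)"
    using warp_ratio_ode[of "r\<^sup>2" K] by (simp add: power2_eq_square mult_ac)
  ultimately show ?thesis by (simp add: warp_eq[abs_def])
qed

lemma warp_cos_square_derivative: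
  "((\<lambda>r. warp_cos K (r\<^sup>2)) has_real_derivative - K * warp K r) (at r)"
proof -
  have "((\<lambda>r. warp_cos K (r\<^sup>2)) has_real_derivative - (K / 2) * warp_ratio K (r\<^sup>2) * (2 * r)) (at r)"
    by (intro DERIV_chain2[OF warp_cos_derivative]) (auto intro!: derivative_eq_intros)
  then show ?thesis by (simp add: warp_eq mult_ac)
qed

lemma admissible_radius_mono:
  assumes "admissible_radius K2 \<rho>" "K1 \<le> K2"
  shows "admissible_radius K1 \<rho>"
  unfolding admissible_radius_def
proof (intro conjI impI)
  assume "K1 > 0"
  then have "pi / sqrt K2 \<le> pi / sqrt K1" using assms(2) by (intro divide_left_mono) auto
  then show "\<rho> < pi / sqrt K1" using assms \<open>K1 > 0\<close> by (auto simp: admissible_radius_def)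
qed (use assms in \<open>simp add: admissible_radius_def\<close>)

text \<open>Sturm comparison: the Wronskian of \<open>h\<close> for the two curvatures has derivative
  \<open>(K2 - K1) h1 h2 > 0\<close>, so \<open>h1 / h2\<close> increases from its limit \<open>1\<close> at the pole.\<close>

lemma warp_strict_antimono:
  assumes adm: "admissible_radius K2 \<rho>" and K: "K1 < K2"
  shows "warp K2 \<rho> < warp K1 \<rho>"
proof -
  have \<rho>: "\<rho> > 0" using adm by (simp add: admissible_radius_def)
  have adm1: "admissible_radius K1 \<rho>" using admissible_radius_mono[OF adm] K by simp
  define W where "W r = warp_cos K1 (r\<^sup>2) * warp K2 r - warp K1 r * warp_cos K2 (r\<^sup>2)" for r
  have dW: "(W has_real_derivative (K2 - K1) * (warp K1 r * warp K2 r)) (at r)" for r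
    unfolding W_def[abs_def]
    by (rule derivative_eq_intros warp_derivative warp_cos_square_derivative refl)+ (simp add: algebra_simps)
  have W: "W r > 0" if r: "0 < r" "r \<le> \<rho>" for r
  proof -
    have "W 0 < W r"
    proof (rule DERIV_pos_imp_increasing_open[OF r(1)])
      fix s assume "0 < s" "s < r"
      then have "(K2 - K1) * (warp K1 s * warp K2 s) > 0"
        using r K by (intro mult_pos_pos warp_pos[OF adm] warp_pos[OF adm1]) auto
      then show "\<exists>y. (W has_real_derivative y) (at s) \<and> 0 < y" using dW by blast
    next
      show "continuous_on {0..r} W"
        using dW by (meson DERIV_isCont continuous_at_imp_continuous_on)
    qed
    then show ?thesis by (simp add: W_def warp_eq)
  qed
  have S2: "warp_ratio K2 (r\<^sup>2) > 0" if "0 \<le> r" "r \<le> \<rho>" for r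
  proof (cases "r = 0")
    case False
    then show ?thesis using warp_pos[OF adm, of r] that by (simp add: warp_eq zero_less_mult_iff)
  qed simp
  \<comment> \<open>The quotient h1 / h2 is 0 / 0 at the pole. Cancelling r leaves a quotient that
    is continuous there, with value 1.\<close>
  let ?q = "\<lambda>r. warp_ratio K1 (r\<^sup>2) / warp_ratio K2 (r\<^sup>2)"
  have "?q 0 < ?q \<rho>"
  proof (rule DERIV_pos_imp_increasing_open[OF \<rho>])
    fix r assume r: "0 < r" "r < \<rho>"
    define S1 S2 D1 D2 where "S1 = warp_ratio K1 (r\<^sup>2)" and "S2 = warp_ratio K2 (r\<^sup>2)"
      and "D1 = warp_ratio_deriv K1 (r\<^sup>2)" and "D2 = warp_ratio_deriv K2 (r\<^sup>2)"
    have S20: "S2 > 0" using S2[of r] r by (simp add: S2_def)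
    have d: "((\<lambda>r. warp_ratio K (r\<^sup>2)) has_real_derivative warp_ratio_deriv K (r\<^sup>2) * (2 * r)) (at r)" for K
      by (intro DERIV_chain2[OF warp_ratio_derivative]) (auto intro!: derivative_eq_intros)
    have "(?q has_real_derivative (D1 * (2 * r) * S2 - S1 * (D2 * (2 * r))) / (S2 * S2)) (at r)"
      unfolding S1_def S2_def D1_def D2_def
      using S20 by (intro DERIV_divide d) (simp add: S2_def)
    \<comment> \<open>By \<open>warp_ratio_ode\<close>, the numerator of the derivative times r^2 is
      exactly the Wronskian.\<close>
    moreover have "r\<^sup>2 * (D1 * (2 * r) * S2 - S1 * (D2 * (2 * r)))
        = r * ((2 * r\<^sup>2 * D1) * S2 - S1 * (2 * r\<^sup>2 * D2))"
      by (simp add: algebra_simps power2_eq_square)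
    then have "r\<^sup>2 * (D1 * (2 * r) * S2 - S1 * (D2 * (2 * r))) = W r"
      unfolding D1_def D2_def warp_ratio_ode W_def warp_eq S1_def S2_def
      by (simp add: algebra_simps)
    then have "D1 * (2 * r) * S2 - S1 * (D2 * (2 * r)) > 0"
      using W[of r] r by (metis less_imp_le zero_less_mult_pos zero_less_power)
    ultimately show "\<exists>y. (?q has_real_derivative y) (at r) \<and> 0 < y"
      using S20 by (meson divide_pos_pos mult_pos_pos)
  next
    show "continuous_on {0..\<rho>} ?q"
      using S2 by (intro continuous_intros continuous_on_compose2[OF continuous_on_warp_ratio]) force+
  qed
  then show ?thesis
    using S2[of \<rho>] \<rho> by (simp add: warp_eq divide_simps)
qed

lemma sigma_radius_eq:
  "admissible_radius K \<rho> \<Longrightarrow> sigma_radius m K \<rho> = real m / warp K \<rho>"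
  by (simp add: sigma_radius_def steklov_sigma_space_form)

section \<open>Areas of geodesic disks\<close>

lemma warp_double: "warp K (2 * r) = 2 * warp K r * warp_cos K (r\<^sup>2)"
  using sin_double[of "sqrt K * r"] sinh_double[of "sqrt (- K) * r"]
  by (auto simp: warp_def warp_cos_eq mult.left_commute)

lemma warp_square: "(warp_cos K (r\<^sup>2))\<^sup>2 = 1 - K * (warp K r)\<^sup>2"
  using warp_pythagoras[of K "r\<^sup>2"] by (simp add: warp_eq power_mult_distrib algebra_simps)

text \<open>The half-angle form of the primitive (1 - cos (q r)) / q^2, where q =
  \<open>sqrt K\<close>; unlike that quotient it also makes sense for \<open>K = 0\<close> and for
  negative \<open>K\<close>.\<close>

lemma half_warp_derivative:
  "((\<lambda>r. 2 * (warp K (r / 2))\<^sup>2) has_real_derivative warp K r) (at r within A)"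
proof -
  have "((\<lambda>r. warp K (r / 2)) has_real_derivative warp_cos K ((r / 2)\<^sup>2) * (1 / 2)) (at r)"
    by (intro DERIV_chain2[OF warp_derivative]) (auto intro!: derivative_eq_intros)
  from DERIV_cmult[OF DERIV_power[OF this, of 2], of 2]
  have "((\<lambda>r. 2 * (warp K (r / 2))\<^sup>2) has_real_derivative warp K r) (at r)"
    using warp_double[of K "r / 2"] by (simp add: mult_ac)
  then show ?thesis by (rule has_field_derivative_at_within)
qed

lemma disk_area_eq:
  assumes "R \<ge> 0"
  shows "disk_area K R = 4 * pi * (warp K (R / 2))\<^sup>2"
proof -
  have "(warp K has_integral 2 * (warp K (R / 2))\<^sup>2 - 2 * (warp K (0 / 2))\<^sup>2) {0..R}"
    using half_warp_derivative assms unfolding has_real_derivative_iff_has_vector_derivative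
    by (intro fundamental_theorem_of_calculus) auto
  then show ?thesis by (simp add: disk_area_def integral_unique warp_eq)
qed

lemma disk_area_strict_mono:
  assumes "admissible_radius K R2" "0 \<le> R1" "R1 < R2"
  shows "disk_area K R1 < disk_area K R2"
proof -
  have "2 * (warp K (R1 / 2))\<^sup>2 < 2 * (warp K (R2 / 2))\<^sup>2"
  proof (rule DERIV_pos_imp_increasing_open[OF assms(3)])
    show "\<exists>y. ((\<lambda>r. 2 * (warp K (r / 2))\<^sup>2) has_real_derivative y) (at r) \<and> 0 < y"
      if "R1 < r" "r < R2" for r
      using that assms half_warp_derivative warp_pos[of K R2 r] by force
    show "continuous_on {R1..R2} (\<lambda>r. 2 * (warp K (r / 2))\<^sup>2)"
      using half_warp_derivative by (meson DERIV_isCont continuous_at_imp_continuous_on)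
  qed
  then show ?thesis using assms by (simp add: disk_area_eq)
qed

text \<open>Intermediate value theorem on an interval at whose right end the area formula is at
  least \<open>A\<close>. For \<open>K > 0\<close> that end is \<open>pi / sqrt K\<close>, with
  total area 4 \<pi> / K > A by the hypothesis on \<open>K\<close>. Otherwise it is the Euclidean
  radius \<open>sqrt (A / pi)\<close>, because h(r) \<ge> r.\<close>

lemma admissible_disk_area_exists:
  assumes A: "A > 0" and K: "K < 4 * pi / A"
  shows "\<exists>R. admissible_radius K R \<and> disk_area K R = A"
proof -
  \<comment> \<open>The last clause rules out the solution r = R when \<open>R\<close> is the
    inadmissible radius \<open>pi / sqrt K\<close>: the area there strictly exceeds
    \<open>A\<close>.\<close>
  obtain R where R: "R > 0" "4 * pi * (warp K (R / 2))\<^sup>2 \<ge> A"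
    "\<And>r. 0 < r \<Longrightarrow> r < R \<Longrightarrow> admissible_radius K r"
    "admissible_radius K R \<or> 4 * pi * (warp K (R / 2))\<^sup>2 \<noteq> A"
  proof (cases "K > 0")
    case True
    have "4 * pi * (warp K (pi / sqrt K / 2))\<^sup>2 = 4 * pi / K"
      using True by (simp add: warp_def power_divide)
    moreover have "4 * pi / K > A" using K A True by (simp add: field_simps)
    ultimately show thesis
      using True by (intro that[of "pi / sqrt K"]) (auto simp: admissible_radius_def)
  next
    case False
    define R where "R = sqrt (A / pi)"
    have R: "R > 0" "R\<^sup>2 = A / pi" using A by (simp_all add: R_def)
    have adm: "admissible_radius K r" if "r > 0" for r using False that by (simp add: admissible_radius_def)
    have "warp K (R / 2) \<ge> R / 2"
      using warp_strict_antimono[of 0 "R / 2" K] False R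
      by (cases "K = 0") (auto simp: admissible_radius_def warp_def)
    then have "(warp K (R / 2))\<^sup>2 \<ge> (R / 2)\<^sup>2" using R by (intro power_mono) auto
    then have "4 * pi * (warp K (R / 2))\<^sup>2 \<ge> A" using R by (simp add: power_divide field_simps)
    then show thesis using adm R by (intro that[of R]) auto
  qed
  let ?a = "\<lambda>r. 4 * pi * (warp K (r / 2))\<^sup>2"
  have "continuous_on {0..R} (\<lambda>r. 2 * (warp K (r / 2))\<^sup>2)"
    using half_warp_derivative by (meson DERIV_isCont continuous_at_imp_continuous_on)
  then have "continuous_on {0..R} (\<lambda>r. 2 * pi * (2 * (warp K (r / 2))\<^sup>2))"
    by (rule continuous_on_mult_left)
  then have "continuous_on {0..R} ?a" by (simp add: mult.assoc[symmetric])
  moreover have "?a 0 \<le> A" using A by (simp add: warp_eq)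
  ultimately obtain r where r: "0 \<le> r" "r \<le> R" "?a r = A"
    using IVT'[of ?a 0 A R] R by auto
  then have "r \<noteq> 0" using A by (auto simp: warp_eq)
  then have "admissible_radius K r" using R(3)[of r] R(4) r by (cases "r = R") auto
  then show ?thesis using r by (auto simp: disk_area_eq)
qed

lemma radius_of_area:
  assumes "A > 0" "K < 4 * pi / A"
  shows "admissible_radius K (radius_of_area K A)" "disk_area K (radius_of_area K A) = A"
proof -
  have "\<exists>!R. admissible_radius K R \<and> disk_area K R = A"
  proof (rule ex_ex1I[OF admissible_disk_area_exists[OF assms]])
    fix R S assume "admissible_radius K R \<and> disk_area K R = A" "admissible_radius K S \<and> disk_area K S = A"
    then show "R = S"
      using disk_area_strict_mono[of K R S] disk_area_strict_mono[of K S R]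
      by (metis admissible_radius_def less_eq_real_def linorder_neqE_linordered_idom order_less_irrefl)
  qed
  from theI'[OF this] show "admissible_radius K (radius_of_area K A)" "disk_area K (radius_of_area K A) = A"
    by (auto simp: radius_of_area_def)
qed

text \<open>With L = 2 \<pi> h(R) the perimeter, this is L^2 = 4 \<pi> A - K A^2, the equality case
  of the isoperimetric inequality. It combines A = 4 \<pi> h(R/2)^2, h(R) = 2 h(R/2) h'(R/2) and
  h'^2 = 1 - K h^2 at R/2.\<close>

lemma warp_radius_of_area:
  assumes "A > 0" "K < 4 * pi / A"
  shows "(warp K (radius_of_area K A))\<^sup>2 = A / pi * (1 - K * A / (4 * pi))"
proof -
  let ?R = "radius_of_area K A"
  have "?R \<ge> 0" using radius_of_area(1)[OF assms] by (simp add: admissible_radius_def)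
  then have a: "(warp K (?R / 2))\<^sup>2 = A / (4 * pi)"
    using radius_of_area(2)[OF assms] by (simp add: disk_area_eq field_simps)
  have "(warp K ?R)\<^sup>2 = 4 * (warp K (?R / 2))\<^sup>2 * (1 - K * (warp K (?R / 2))\<^sup>2)"
    using warp_double[of K "?R / 2"] by (simp add: power_mult_distrib warp_square)
  then show ?thesis unfolding a by simp
qed

theorem corollary10:
  fixes m :: nat
  assumes "m \<ge> 1"
  shows "(\<forall>A>0. strict_mono_on {..<4 * pi / A} (\<lambda>K. sigma_area m K A)) \<and>
    (\<forall>\<rho>>0. strict_mono_on {..<(pi / \<rho>)\<^sup>2} (\<lambda>K. sigma_radius m K \<rho>))"
proof (intro conjI allI impI)
  have less: "real m / a < real m / b" if "0 < b" "b < a" for a b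
    using that assms by (intro divide_strict_left_mono) auto
  {
    fix A :: real assume A: "A > 0"
    show "strict_mono_on {..<4 * pi / A} (\<lambda>K. sigma_area m K A)"
    proof (rule strict_mono_onI)
      fix K L assume KL: "K \<in> {..<4 * pi / A}" "L \<in> {..<4 * pi / A}" "K < L"
      let ?h = "\<lambda>K. warp K (radius_of_area K A)"
      have pos: "?h L > 0" "?h K > 0"
        using warp_pos[OF radius_of_area(1)] radius_of_area(1) A KL
        by (auto simp: admissible_radius_def)
      \<comment> \<open>For fixed \<open>A\<close>, the square of h at the boundary is a decreasing
        affine function of the curvature, by \<open>warp_radius_of_area\<close>.\<close>
      have "K * A / (4 * pi) < L * A / (4 * pi)" using A KL(3) by (simp add: field_simps)
      then have "(?h L)\<^sup>2 < (?h K)\<^sup>2"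
        using A KL by (simp add: warp_radius_of_area divide_strict_right_mono)
      then have "?h L < ?h K" using pos by (simp add: power2_less_imp_less)
      then show "sigma_area m K A < sigma_area m L A"
        using less pos A KL by (simp add: sigma_area_def sigma_radius_eq radius_of_area)
    qed
  next
    fix \<rho> :: real assume \<rho>: "\<rho> > 0"
    have adm: "admissible_radius K \<rho>" if "K < (pi / \<rho>)\<^sup>2" for K
    proof -
      have "\<rho> < pi / sqrt K" if "K > 0"
      proof -
        have "sqrt K < pi / \<rho>" using \<open>K < (pi / \<rho>)\<^sup>2\<close> \<rho> by (intro real_less_lsqrt) auto
        then show ?thesis using that \<rho> by (simp add: field_simps)
      qed
      then show ?thesis using \<rho> by (simp add: admissible_radius_def)
    qed
    show "strict_mono_on {..<(pi / \<rho>)\<^sup>2} (\<lambda>K. sigma_radius m K \<rho>)"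
    proof (rule strict_mono_onI)
      fix K L assume KL: "K \<in> {..<(pi / \<rho>)\<^sup>2}" "L \<in> {..<(pi / \<rho>)\<^sup>2}" "K < L"
      then have "warp L \<rho> < warp K \<rho>" "warp L \<rho> > 0"
        using warp_strict_antimono[OF adm] warp_pos[OF adm] \<rho> by auto
      then show "sigma_radius m K \<rho> < sigma_radius m L \<rho>"
        using less adm KL by (simp add: sigma_radius_eq)
    qed
  }
qed

end
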